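(* Let $A\in\mathbb{R}^{m\times n}$ and $\lambda\in\mathbb{R}$ be fixed. For $\theta\in\mathbb{R}^m$ let $x^\star_{\min}(\theta)$ denote the minimal Euclidean norm element of the solution set of the LASSO problem $$\min_{x\in\mathbb{R}^n}\left\{\tfrac12\|Ax-\theta\|_2^2+e^\lambda\|x\|_1\right\}.$$ Then $\theta\mapsto x^\star_{\min}(\theta)$ is path-differentiable on $\mathbb{R}^m$.
   Context: A locally Lipschitz map $G:\mathbb{R}^m\to\mathbb{R}^n$ is path-differentiable if it admits a conservative Jacobian, i.e. a set-valued map $J_G:\mathbb{R}^m\rightrightarrows\mathbb{R}^{n\times m}$ that is nonempty-valued, locally bounded, has closed graph, and such that for every absolutely continuous curve $\mu:[0,1]\to\mathbb{R}^m$ and almost every $t\in[0,1]$, $\frac{d}{dt}G(\mu(t))=V\dot\mu(t)$ for all $V\in J_G(\mu(t))$. *)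

theory Defs
  imports "HOL-Analysis.Analysis"
begin

(* Degenerate intervals are allowed in a division, but contribute 0 to both sums. *)
definition absolutely_continuous_curve :: "real set \<Rightarrow> (real \<Rightarrow> 'a::real_normed_vector) \<Rightarrow> bool"
  where "absolutely_continuous_curve I \<mu> \<longleftrightarrow>
    (\<forall>\<epsilon>>0. \<exists>\<delta>>0. \<forall>D S. D division_of S \<and> S \<subseteq> I \<and> (\<Sum>K\<in>D. Sup K - Inf K) < \<delta> \<longrightarrow>
       (\<Sum>K\<in>D. norm (\<mu> (Sup K) - \<mu> (Inf K))) < \<epsilon>)"

definition locally_lipschitz :: "('a::metric_space \<Rightarrow> 'b::metric_space) \<Rightarrow> bool"
  where "locally_lipschitz G \<longleftrightarrow> (\<forall>x. \<exists>r>0. \<exists>L. L-lipschitz_on (ball x r) G)"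

definition locally_bounded_map :: "('a::metric_space \<Rightarrow> 'b::metric_space set) \<Rightarrow> bool"
  where "locally_bounded_map J \<longleftrightarrow> (\<forall>x. \<exists>r>0. bounded (\<Union>y\<in>ball x r. J y))"

(* An n-by-m matrix has type real ^ 'm ^ 'n, and Sigma UNIV J is the graph of J.
   Existence of both derivatives is part of the chain rule; V is quantified after
   the exceptional null set has been chosen. *)
definition conservative_jacobian ::
  "(real ^ 'm \<Rightarrow> real ^ 'n) \<Rightarrow> (real ^ 'm \<Rightarrow> (real ^ 'm ^ 'n) set) \<Rightarrow> bool"
  where "conservative_jacobian G J \<longleftrightarrow>
    (\<forall>x. J x \<noteq> {}) \<and> locally_bounded_map J \<and> closed (Sigma UNIV J) \<and>
    (\<forall>\<mu>. absolutely_continuous_curve {0..1} \<mu> \<longrightarrow>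
      (AE t in lebesgue_on {0..1}.
        \<exists>d. (\<mu> has_vector_derivative d) (at t within {0..1}) \<and>
            (\<forall>V\<in>J (\<mu> t). ((\<lambda>s. G (\<mu> s)) has_vector_derivative V *v d) (at t within {0..1}))))"

definition path_differentiable :: "(real ^ 'm \<Rightarrow> real ^ 'n) \<Rightarrow> bool"
  where "path_differentiable G \<longleftrightarrow> locally_lipschitz G \<and> (\<exists>J. conservative_jacobian G J)"

definition lasso_objective :: "real ^ 'n ^ 'm \<Rightarrow> real \<Rightarrow> real ^ 'm \<Rightarrow> real ^ 'n \<Rightarrow> real"
  where "lasso_objective A lam \<theta> x =
    1 / 2 * (norm (A *v x - \<theta>))\<^sup>2 + exp lam * (\<Sum>i\<in>UNIV. \<bar>x $ i\<bar>)"

definition lasso_solutions :: "real ^ 'n ^ 'm \<Rightarrow> real \<Rightarrow> real ^ 'm \<Rightarrow> (real ^ 'n) set"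
  where "lasso_solutions A lam \<theta> = {x. is_arg_min (lasso_objective A lam \<theta>) (\<lambda>_. True) x}"

(* The solution set is nonempty, closed and convex, so the choice made by arg_min_on is unique. *)
definition lasso_min_norm :: "real ^ 'n ^ 'm \<Rightarrow> real \<Rightarrow> real ^ 'm \<Rightarrow> real ^ 'n"
  where "lasso_min_norm A lam \<theta> = arg_min_on norm (lasso_solutions A lam \<theta>)"

end

theory Submission
  imports Defs
begin

text \<open>On the set of all \<open>\<theta>\<close> whose minimal norm solution has a given sign vector, the optimality
  conditions on the support, together with orthogonality to the kernel of \<open>A\<close> restricted to the
  support, determine the solution as an affine function of \<open>\<theta>\<close>. There are finitely many sign
  vectors, and the solution map is continuous because its graph is closed: if \<open>x\<close> is a limit of
  minimal norm solutions and \<open>z\<close> is the minimal norm solution at the limit, then moving slightly in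
  direction \<open>z - x\<close> keeps the approximating points optimal, and decreases their norm unless \<open>z = x\<close>.

  A continuous map that agrees everywhere with one of finitely many affine maps is Lipschitz, and
  the linear parts of the active affine maps form a conservative Jacobian. Along a curve, for almost
  every \<open>t\<close> both the curve and its image are differentiable at \<open>t\<close>, and \<open>t\<close> is an accumulation point
  of the times at which any given map active at \<open>t\<close> is active; the derivatives therefore match.
  The almost everywhere differentiability of absolutely continuous curves is obtained directly
  from the Vitali covering theorem.\<close>

section \<open>Absolutely continuous curves\<close>

lemma division_of_realE:
  fixes D :: "real set set"
  assumes "D division_of S" "K \<in> D"
  obtains a b where "a \<le> b" "K = {a..b}"
proof -
  obtain a b where ab: "K = cbox a b"
    using division_ofD(4)[OF assms] by (elim exE)
  then have "a \<le> b" "K = {a..b}"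
    using division_ofD(3)[OF assms] by simp_all
  then show ?thesis by (rule that)
qed

text \<open>Tagging each piece by its left end point gives a tagged division, for which additivity
  of increments is known.\<close>

lemma sum_division_telescope:
  fixes f :: "real \<Rightarrow> 'a::real_normed_vector"
  assumes "a \<le> b" "D division_of {a..b}"
  shows "(\<Sum>K\<in>D. f (Sup K) - f (Inf K)) = f b - f a"
proof -
  let ?T = "(\<lambda>K. (Inf K, K)) ` D"
  have tags: "Inf K \<in> K" if "K \<in> D" for K
    using division_of_realE[OF assms(2) that] by (metis cInf_atLeastAtMost atLeastAtMost_iff order_refl)
  have "?T tagged_division_of {a..b}"
  proof (rule tagged_division_ofI)
    show "finite ?T" using assms(2) by blast
    show "\<Union>{K. \<exists>x. (x, K) \<in> ?T} = {a..b}"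
    proof -
      have "{K. \<exists>x. (x, K) \<in> ?T} = D" by auto
      then show ?thesis using division_ofD(6)[OF assms(2)] by simp
    qed
    fix x K assume xK: "(x, K) \<in> ?T"
    then have K: "K \<in> D" "x = Inf K" by auto
    show "x \<in> K" using tags K by simp
    show "K \<subseteq> {a..b}" "\<exists>a b. K = cbox a b" using division_ofD(2,4)[OF assms(2) K(1)] by auto
    fix y L assume "(y, L) \<in> ?T" "(x, K) \<noteq> (y, L)"
    then have "L \<in> D" "K \<noteq> L" using K by auto
    then show "interior K \<inter> interior L = {}" using division_ofD(5)[OF assms(2) K(1)] by simp
  qed
  from additive_tagged_division_1[OF assms(1) this, of f]
  show ?thesis
    by (subst (asm) sum.reindex) (auto simp: inj_on_def)
qed

text \<open>On the line closed balls are intervals, so the Vitali covering theorem yields countably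
  many disjoint intervals covering \<open>E\<close> up to a null set, and finitely many of them
  carry almost all of the measure. \<open>Q\<close> stands for the slope conditions imposed
  later.\<close>

lemma vitali_finite_selection:
  fixes E U :: "real set"
  assumes E: "E \<in> sets lebesgue" and U: "open U" "U \<in> lmeasurable" "E \<subseteq> U"
    and fine: "\<And>x d. x \<in> E \<Longrightarrow> d > 0 \<Longrightarrow> \<exists>u v. u < v \<and> x \<in> {u..v} \<and> v - u < d \<and> Q u v"
    and "\<eta> > 0"
  obtains D where "D division_of \<Union>D" "disjoint D" "\<Union>D \<subseteq> U"
    "\<And>K. K \<in> D \<Longrightarrow> \<exists>u v. u < v \<and> K = {u..v} \<and> Q u v"
    "measure lebesgue E - \<eta> < (\<Sum>K\<in>D. Sup K - Inf K)"
    "(\<Sum>K\<in>D. Sup K - Inf K) \<le> measure lebesgue U"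
proof -
  define I where "I = {(u, v). u < v \<and> {u..v} \<subseteq> U \<and> Q u v}"
  \<comment> \<open>The covering theorem speaks of balls: an interval is indexed by its end points
    and read as midpoint and radius.\<close>
  define a where "a = (\<lambda>(u::real, v). (u + v) / 2)"
  define r where "r = (\<lambda>(u::real, v). (v - u) / 2)"
  have ball: "cball (a (u, v)) (r (u, v)) = {u..v}" for u v
    by (auto simp: a_def r_def cball_eq_atLeastAtMost field_simps)
  have small: "\<exists>i. i \<in> I \<and> x \<in> cball (a i) (r i) \<and> r i < d" if x: "x \<in> E" and "0 < d" for x d
  proof -
    have "x \<in> U" using U(3) x by blast
    then obtain e where e: "e > 0" "ball x e \<subseteq> U"
      using U(1) unfolding open_contains_ball by blast
    obtain u v where uv: "u < v" "x \<in> {u..v}" "v - u < min d e" "Q u v"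
      using fine[OF x, of "min d e"] \<open>0 < d\<close> e(1) by auto
    have "{u..v} \<subseteq> U"
      using uv e(2) by (force simp: ball_def dist_real_def)
    then show ?thesis
      using uv ball[of u v] by (intro exI[of _ "(u, v)"]) (auto simp: I_def r_def)
  qed
  have pos: "0 < r i" if "i \<in> I" for i
    using that by (auto simp: I_def r_def)
  obtain C where C: "countable C" "C \<subseteq> I"
     "pairwise (\<lambda>i j. disjnt (cball (a i) (r i)) (cball (a j) (r j))) C"
     "negligible (E - (\<Union>i\<in>C. cball (a i) (r i)))"
    by (rule Vitali_covering_theorem_cballs[where K = I and r = r and a = a and S = E])
      (erule pos, erule small, assumption, rule that)
  define \<D> where "\<D> = (\<lambda>i. cball (a i) (r i)) ` C"
  have form: "\<exists>u v. u < v \<and> K = {u..v} \<and> Q u v \<and> K \<subseteq> U" if K: "K \<in> \<D>" for K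
  proof -
    obtain u v where "(u, v) \<in> C" "K = {u..v}"
      using K ball by (auto simp: \<D>_def)
    moreover have "u < v" "{u..v} \<subseteq> U" "Q u v"
      using C(2) \<open>(u, v) \<in> C\<close> by (auto simp: I_def)
    ultimately show ?thesis by blast
  qed
  have disj: "disjoint \<D>"
    unfolding \<D>_def using C(3) by (auto simp: pairwise_def)
  have sub: "\<Union>\<D> \<subseteq> U" using form by blast
  have lm: "\<And>K. K \<in> \<D> \<Longrightarrow> K \<in> lmeasurable"
  proof -
    fix K assume "K \<in> \<D>"
    then obtain u v where "K = {u..v}" using form by blast
    then show "K \<in> lmeasurable" by simp
  qed
  have cnt: "countable \<D>" using C(1) by (simp add: \<D>_def)
  \<comment> \<open>A bound uniform over finite subfamilies lets a finite one come within \<eta> of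
    the measure of the countable union.\<close>
  have B: "measure lebesgue (\<Union>\<D>') \<le> measure lebesgue U" if "\<D>' \<subseteq> \<D>" "finite \<D>'" for \<D>'
    using that sub lm by (intro measure_mono_fmeasurable U(2) fmeasurableD)
      (auto intro!: fmeasurable.finite_Union)
  obtain D where D: "D \<subseteq> \<D>" "finite D" "measure lebesgue (\<Union>\<D>) - \<eta> < measure lebesgue (\<Union>D)"
    by (rule measure_countable_Union_approachable[OF cnt \<open>\<eta> > 0\<close>])
      (erule lm, erule B, assumption, rule that)
  have U\<D>: "\<Union>\<D> \<in> lmeasurable"
    using cnt lm sub U(2)
    by (intro fmeasurableI2[OF U(2) sub] sets.countable_Union) (auto simp: fmeasurableD)
  have neg: "negligible (E - \<Union>\<D>)"
    using C(4) by (simp add: \<D>_def)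
  have "measure lebesgue E \<le> measure lebesgue (\<Union>\<D> \<union> (E - \<Union>\<D>))"
    by (rule measure_mono_fmeasurable[OF _ E fmeasurable.Un[OF U\<D> negligible_imp_measurable[OF neg]]]) blast
  also have "\<dots> = measure lebesgue (\<Union>\<D>)"
    using neg U\<D> by (intro measure_Un_null_set) (simp_all add: negligible_iff_null_sets fmeasurableD)
  finally have big: "measure lebesgue E - \<eta> < measure lebesgue (\<Union>D)"
    using D(3) by linarith
  have div: "D division_of \<Union>D"
  proof (rule division_ofI)
    show "interior K1 \<inter> interior K2 = {}" if "K1 \<in> D" "K2 \<in> D" "K1 \<noteq> K2" for K1 K2
    proof -
      have "K1 \<in> \<D>" "K2 \<in> \<D>" using that D(1) by auto
      then have "K1 \<inter> K2 = {}" using disj \<open>K1 \<noteq> K2\<close> by (auto simp: pairwise_def disjnt_def)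
      then show ?thesis using interior_subset[of K1] interior_subset[of K2] by blast
    qed
    show "K \<noteq> {}" "\<exists>a b. K = cbox a b" if "K \<in> D" for K
    proof -
      obtain u v where "u < v" "K = {u..v}" using form D(1) \<open>K \<in> D\<close> by blast
      then show "K \<noteq> {}" "\<exists>a b. K = cbox a b" by (auto intro!: exI[of _ u] exI[of _ v])
    qed
  qed (use D in auto)
  have disjD: "disjoint D" using disj D(1) by (rule pairwise_subset)
  have len: "measure lebesgue (\<Union>D) = (\<Sum>K\<in>D. Sup K - Inf K)"
  proof -
    have "measure lebesgue (\<Union>D) = (\<Sum>K\<in>D. measure lebesgue K)"
      using D lm disj pairwise_subset by (intro measure_Union') auto
    also have "\<dots> = (\<Sum>K\<in>D. Sup K - Inf K)"
      using D(1) form by (intro sum.cong) force+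
    finally show ?thesis .
  qed
  have up: "measure lebesgue (\<Union>D) \<le> measure lebesgue U"
    using B D by blast
  have formD: "\<exists>u v. u < v \<and> K = {u..v} \<and> Q u v" if "K \<in> D" for K
    using form D(1) that by blast
  have subD: "\<Union>D \<subseteq> U" using D(1) sub by blast
  show ?thesis
    by (rule that[OF div disjD subD formD big[unfolded len] up[unfolded len]])
qed

text \<open>An isolated point is the only point of \<open>T\<close> in some member of a countable
  basis, so that member determines it. For the times at which a given affine map is active, only a
  null set is lost.\<close>

lemma countable_isolated_points:
  fixes T :: "'a::second_countable_topology set"
  shows "countable {x \<in> T. \<not> x islimpt T}"
proof -
  obtain \<B> :: "'a set set" where \<B>: "countable \<B>" "\<And>W x. open W \<Longrightarrow> x \<in> W \<Longrightarrow> \<exists>B\<in>\<B>. x \<in> B \<and> B \<subseteq> W"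
  proof -
    obtain \<B> :: "'a set set" where \<B>: "countable \<B>" "topological_basis \<B>"
      using ex_countable_basis by blast
    show ?thesis
    proof (rule that[OF \<B>(1)])
      fix W and x :: 'a assume "open W" "x \<in> W"
      then obtain B where "B \<in> \<B>" "x \<in> B" "B \<subseteq> W"
        by (rule topological_basisE[OF \<B>(2)])
      then show "\<exists>B\<in>\<B>. x \<in> B \<and> B \<subseteq> W" by blast
    qed
  qed
  have ex: "\<exists>B\<in>\<B>. B \<inter> T = {x}" if "x \<in> T" "\<not> x islimpt T" for x
  proof -
    obtain W where "x \<in> W" "open W" and W: "\<forall>y\<in>T. y \<in> W \<longrightarrow> y = x"
      using \<open>\<not> x islimpt T\<close> by (auto simp: islimpt_def)
    then have "W \<inter> T \<subseteq> {x}" by auto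
    obtain B where "B \<in> \<B>" "x \<in> B" "B \<subseteq> W"
      using \<B>(2)[OF \<open>open W\<close> \<open>x \<in> W\<close>] by (elim bexE conjE)
    then have "B \<inter> T = {x}" using \<open>W \<inter> T \<subseteq> {x}\<close> \<open>x \<in> T\<close> by blast
    then show ?thesis using \<open>B \<in> \<B>\<close> by (rule bexI)
  qed
  have "{x \<in> T. \<not> x islimpt T} \<subseteq> (\<lambda>B. the_elem (B \<inter> T)) ` \<B>"
  proof (intro subsetI)
    fix x assume "x \<in> {x \<in> T. \<not> x islimpt T}"
    then obtain B where B: "B \<in> \<B>" "B \<inter> T = {x}" using ex by blast
    then show "x \<in> (\<lambda>B. the_elem (B \<inter> T)) ` \<B>" by (intro image_eqI[OF _ B(1)]) simp
  qed
  then show ?thesis by (rule countable_subset) (use \<B>(1) in simp)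
qed

text \<open>Inside each member of \<open>P\<close>, the pieces of \<open>D\<close> extend to a
  division of that member; the added pieces form \<open>R\<close>, and increments telescope member
  by member. The identity holds for every \<open>h\<close> because it is applied both to lengths and
  to increments of a function.\<close>

lemma refinement_gaps:
  fixes P D :: "real set set"
  assumes P: "P division_of \<Union>P" "disjoint P"
    and D: "D division_of \<Union>D" and ref: "\<And>L. L \<in> D \<Longrightarrow> \<exists>K\<in>P. L \<subseteq> K"
  obtains R where "R division_of \<Union>R" "\<Union>R \<subseteq> \<Union>P"
    "\<And>h :: real \<Rightarrow> real. (\<Sum>K\<in>P. h (Sup K) - h (Inf K)) =
      (\<Sum>K\<in>D. h (Sup K) - h (Inf K)) + (\<Sum>K\<in>R. h (Sup K) - h (Inf K))"
proof -
  define D' where "D' K = {L \<in> D. L \<subseteq> K}" for K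
  have "\<exists>g. D' K \<subseteq> g \<and> g division_of K" if "K \<in> P" for K
  proof -
    obtain a b where K: "K = cbox a b"
      using division_ofD(4)[OF P(1) \<open>K \<in> P\<close>] by blast
    have "D' K division_of \<Union>(D' K)"
      using division_of_subset[OF D, of "D' K"] by (auto simp: D'_def)
    moreover have "\<Union>(D' K) \<subseteq> cbox a b" by (auto simp: D'_def K)
    ultimately show ?thesis
      using partial_division_extend_interval[of "D' K" a b] K by metis
  qed
  then obtain g where g: "\<And>K. K \<in> P \<Longrightarrow> D' K \<subseteq> g K" "\<And>K. K \<in> P \<Longrightarrow> g K division_of K"
    by metis
  define R where "R = (\<Union>K\<in>P. g K - D' K)"
  have finP: "finite P" using P(1) by blast
  have fing: "finite (g K)" if "K \<in> P" for K
    using g(2)[OF that] by blast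
  have gK: "L \<noteq> {}" "L \<subseteq> K" "\<exists>a b. L = cbox a b" if "K \<in> P" "L \<in> g K" for K L
    using division_ofD(2,3,4)[OF g(2)[OF that(1)] that(2)] by auto
  \<comment> \<open>Members of \<open>P\<close> are disjoint and pieces are nonempty, so pieces from
    different members are distinct and the sums regroup without double counting.\<close>
  have disj: "L1 \<noteq> L2" "interior L1 \<inter> interior L2 = {}"
    if "K1 \<in> P" "K2 \<in> P" "K1 \<noteq> K2" "L1 \<in> g K1" "L2 \<in> g K2" for K1 K2 L1 L2
  proof -
    have "K1 \<inter> K2 = {}" using P(2) that by (auto simp: pairwise_def disjnt_def)
    then have "L1 \<inter> L2 = {}" using gK(2) that by blast
    then show "L1 \<noteq> L2" "interior L1 \<inter> interior L2 = {}"
      using gK(1) that interior_subset by (blast, blast)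
  qed
  have div: "R division_of \<Union>R"
  proof (rule division_ofI)
    show "finite R" unfolding R_def using finP fing by (intro finite_UN_I) (auto intro: finite_subset)
    fix L assume "L \<in> R"
    then show "L \<noteq> {}" "\<exists>a b. L = cbox a b" using gK by (auto simp: R_def)
    fix L' assume L': "L' \<in> R" "L \<noteq> L'"
    obtain K K' where K: "K \<in> P" "K' \<in> P" "L \<in> g K" "L' \<in> g K'"
      using \<open>L \<in> R\<close> L' by (auto simp: R_def)
    show "interior L \<inter> interior L' = {}"
    proof (cases "K = K'")
      case True
      then show ?thesis using division_ofD(5)[OF g(2)[OF K(1)]] K L'(2) by blast
    next
      case False
      then show ?thesis using disj(2) K by blast
    qed
  qed auto
  have sub: "\<Union>R \<subseteq> \<Union>P" using gK(2) by (fastforce simp: R_def)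
  have "(\<Sum>K\<in>P. h (Sup K) - h (Inf K)) =
      (\<Sum>K\<in>D. h (Sup K) - h (Inf K)) + (\<Sum>K\<in>R. h (Sup K) - h (Inf K))" for h :: "real \<Rightarrow> real"
  proof -
    define \<Delta> where "\<Delta> K = h (Sup K) - h (Inf K)" for K
    have "\<Delta> K = sum \<Delta> (D' K) + sum \<Delta> (g K - D' K)" if K: "K \<in> P" for K
    proof -
      obtain a b where ab: "a \<le> b" "K = {a..b}"
        by (rule division_of_realE[OF P(1) K])
      then have "\<Delta> K = sum \<Delta> (g K)"
        using sum_division_telescope[of a b "g K" h] g(2)[OF K] by (simp add: \<Delta>_def)
      then show ?thesis using sum.subset_diff[OF g(1)[OF K] fing[OF K], of \<Delta>] by simp
    qed
    then have "sum \<Delta> P = (\<Sum>K\<in>P. sum \<Delta> (D' K)) + (\<Sum>K\<in>P. sum \<Delta> (g K - D' K))"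
      by (simp add: sum.distrib)
    also have "(\<Sum>K\<in>P. sum \<Delta> (g K - D' K)) = sum \<Delta> R"
      unfolding R_def
    proof (rule sum.UNION_disjoint[symmetric])
      show "\<forall>i\<in>P. \<forall>j\<in>P. i \<noteq> j \<longrightarrow> (g i - D' i) \<inter> (g j - D' j) = {}"
        using disj(1) by blast
    qed (use finP fing in auto)
    also have "(\<Sum>K\<in>P. sum \<Delta> (D' K)) = sum \<Delta> (\<Union>K\<in>P. D' K)"
    proof (rule sum.UNION_disjoint[symmetric])
      show "\<forall>i\<in>P. \<forall>j\<in>P. i \<noteq> j \<longrightarrow> D' i \<inter> D' j = {}"
        using disj(1) g(1) by blast
      show "\<forall>K\<in>P. finite (D' K)"
        using fing g(1) finite_subset by blast
    qed (use finP in auto)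
    also have "(\<Union>K\<in>P. D' K) = D"
      using ref by (auto simp: D'_def)
    finally show ?thesis by (simp add: \<Delta>_def)
  qed
  then show ?thesis by (rule that[OF div sub])
qed

section \<open>Elementary consequences of absolute continuity\<close>

lemma absolutely_continuous_curveD:
  assumes "absolutely_continuous_curve I \<mu>" "\<epsilon> > 0"
  shows "\<exists>\<delta>>0. \<forall>D. D division_of \<Union>D \<and> \<Union>D \<subseteq> I \<and> (\<Sum>K\<in>D. Sup K - Inf K) < \<delta> \<longrightarrow>
      (\<Sum>K\<in>D. norm (\<mu> (Sup K) - \<mu> (Inf K))) < \<epsilon>"
proof -
  obtain \<delta> where "\<delta> > 0" and \<delta>: "\<forall>D S. D division_of S \<and> S \<subseteq> I \<and> (\<Sum>K\<in>D. Sup K - Inf K) < \<delta> \<longrightarrow>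
       (\<Sum>K\<in>D. norm (\<mu> (Sup K) - \<mu> (Inf K))) < \<epsilon>"
    using assms unfolding absolutely_continuous_curve_def by blast
  show ?thesis
  proof (intro exI[of _ \<delta>] conjI allI impI)
    show "\<delta> > 0" by fact
    show "(\<Sum>K\<in>D. norm (\<mu> (Sup K) - \<mu> (Inf K))) < \<epsilon>"
      if "D division_of \<Union>D \<and> \<Union>D \<subseteq> I \<and> (\<Sum>K\<in>D. Sup K - Inf K) < \<delta>" for D
      using \<delta>[rule_format, OF that] .
  qed
qed

text \<open>Transfers absolute continuity to negatives, coordinates and Lipschitz images, whose
  increments are dominated by those of \<mu>.\<close>

lemma absolutely_continuous_curve_bounded_by:
  assumes "absolutely_continuous_curve I \<mu>" and "L \<ge> 0"
    and le: "\<And>s t. s \<in> I \<Longrightarrow> t \<in> I \<Longrightarrow> norm (\<nu> s - \<nu> t) \<le> L * norm (\<mu> s - \<mu> t)"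
  shows "absolutely_continuous_curve I \<nu>"
  unfolding absolutely_continuous_curve_def
proof (intro allI impI)
  fix \<epsilon> :: real assume "\<epsilon> > 0"
  \<comment> \<open>\<open>L + 1\<close> keeps the quotient meaningful for \<open>L = 0\<close> and
    makes the final inequality strict.\<close>
  then have pos: "\<epsilon> / (L + 1) > 0" using \<open>L \<ge> 0\<close> by simp
  obtain \<delta> where \<delta>: "\<delta> > 0"
    "\<forall>D. D division_of \<Union>D \<and> \<Union>D \<subseteq> I \<and> (\<Sum>K\<in>D. Sup K - Inf K) < \<delta> \<longrightarrow>
      (\<Sum>K\<in>D. norm (\<mu> (Sup K) - \<mu> (Inf K))) < \<epsilon> / (L + 1)"
    using absolutely_continuous_curveD[OF assms(1) pos] by (elim exE conjE) (rule that)
  have main: "(\<Sum>K\<in>D. norm (\<nu> (Sup K) - \<nu> (Inf K))) < \<epsilon>"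
    if D: "D division_of S" "S \<subseteq> I" "(\<Sum>K\<in>D. Sup K - Inf K) < \<delta>" for D S
  proof -
    have "S = \<Union>D" using D(1) by auto
    have ends: "Sup K \<in> I" "Inf K \<in> I" if "K \<in> D" for K
    proof -
      obtain a b where "a \<le> b" "K = {a..b}"
        by (rule division_of_realE[OF D(1) \<open>K \<in> D\<close>])
      moreover have "K \<subseteq> I" using division_ofD(2)[OF D(1) \<open>K \<in> D\<close>] D(2) by blast
      ultimately show "Sup K \<in> I" "Inf K \<in> I" by auto
    qed
    have "(\<Sum>K\<in>D. norm (\<nu> (Sup K) - \<nu> (Inf K))) \<le> (\<Sum>K\<in>D. L * norm (\<mu> (Sup K) - \<mu> (Inf K)))"
      by (intro sum_mono le ends)
    also have "\<dots> = L * (\<Sum>K\<in>D. norm (\<mu> (Sup K) - \<mu> (Inf K)))"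
      by (simp add: sum_distrib_left)
    also have "\<dots> \<le> L * (\<epsilon> / (L + 1))"
    proof (rule mult_left_mono[OF less_imp_le \<open>L \<ge> 0\<close>])
      show "(\<Sum>K\<in>D. norm (\<mu> (Sup K) - \<mu> (Inf K))) < \<epsilon> / (L + 1)"
        by (rule \<delta>(2)[rule_format]) (use D \<open>S = \<Union>D\<close> in blast)
    qed
    also have "\<dots> < \<epsilon>" using \<open>L \<ge> 0\<close> \<open>\<epsilon> > 0\<close> by (simp add: field_simps)
    finally show ?thesis .
  qed
  show "\<exists>\<delta>>0. \<forall>D S. D division_of S \<and> S \<subseteq> I \<and> (\<Sum>K\<in>D. Sup K - Inf K) < \<delta> \<longrightarrow>
       (\<Sum>K\<in>D. norm (\<nu> (Sup K) - \<nu> (Inf K))) < \<epsilon>"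
  proof (intro exI[of _ \<delta>] conjI allI impI)
    show "\<delta> > 0" by fact
    fix D S assume "D division_of S \<and> S \<subseteq> I \<and> (\<Sum>K\<in>D. Sup K - Inf K) < \<delta>"
    then show "(\<Sum>K\<in>D. norm (\<nu> (Sup K) - \<nu> (Inf K))) < \<epsilon>" by (elim conjE) (rule main)
  qed
qed

text \<open>A single interval is a division of itself, so one short interval already has a small
  increment.\<close>

lemma absolutely_continuous_imp_isCont:
  assumes "absolutely_continuous_curve {a..b} \<mu>" "t \<in> {a<..<b}"
  shows "isCont \<mu> t"
  unfolding continuous_at_eps_delta
proof (intro allI impI)
  fix \<epsilon> :: real assume "\<epsilon> > 0"
  obtain \<delta> where \<delta>: "\<delta> > 0"
    "\<forall>D. D division_of \<Union>D \<and> \<Union>D \<subseteq> {a..b} \<and> (\<Sum>K\<in>D. Sup K - Inf K) < \<delta> \<longrightarrow>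
      (\<Sum>K\<in>D. norm (\<mu> (Sup K) - \<mu> (Inf K))) < \<epsilon>"
    using absolutely_continuous_curveD[OF assms(1) \<open>\<epsilon> > 0\<close>] by (elim exE conjE) (rule that)
  have le: "norm (\<mu> v - \<mu> u) < \<epsilon>" if "u \<le> v" "{u..v} \<subseteq> {a..b}" "v - u < \<delta>" for u v
  proof -
    have "{{u..v}} division_of \<Union>{{u..v}}"
      using division_of_self[of u v, unfolded box_real] that(1) by simp
    then have "(\<Sum>K\<in>{{u..v}}. norm (\<mu> (Sup K) - \<mu> (Inf K))) < \<epsilon>"
      by (intro \<delta>(2)[rule_format] conjI) (use that in simp_all)
    then show ?thesis using that(1) by simp
  qed
  \<comment> \<open>The inner minimum keeps the interval between \<open>s\<close> and
    \<open>t\<close> inside \<open>{a..b}\<close>.\<close>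
  have close: "dist (\<mu> s) (\<mu> t) < \<epsilon>" if s: "dist s t < min \<delta> (min (t - a) (b - t))" for s
  proof (cases "s \<le> t")
    case True
    then have "norm (\<mu> t - \<mu> s) < \<epsilon>"
      using s assms(2) by (intro le) (auto simp: dist_real_def)
    then show ?thesis by (simp add: dist_norm norm_minus_commute)
  next
    case False
    then have "norm (\<mu> s - \<mu> t) < \<epsilon>"
      using s assms(2) by (intro le) (auto simp: dist_real_def)
    then show ?thesis by (simp add: dist_norm)
  qed
  show "\<exists>d>0. \<forall>x'. dist x' t < d \<longrightarrow> dist (\<mu> x') (\<mu> t) < \<epsilon>"
  proof (intro exI conjI allI impI)
    show "0 < min \<delta> (min (t - a) (b - t))" using \<delta>(1) assms(2) by simp
  qed (rule close)
qed

section \<open>Differentiability almost everywhere\<close>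

text \<open>The chords strictly straddle \<open>x\<close>, which makes the set a \<open>G\<^sub>\<delta>\<close> for arbitrary \<open>f\<close>.\<close>

definition steep :: "(real \<Rightarrow> real) \<Rightarrow> real \<Rightarrow> real set"
  where "steep f q =
    {x. \<forall>d>0. \<exists>u v. u < x \<and> x < v \<and> v - u < d \<and> q * (v - u) < f v - f u}"

lemma borel_steep: "steep f q \<in> sets borel"
proof -
  \<comment> \<open>\<open>W n\<close> is the open set of points strictly inside a steep chord
    shorter than \<open>1 / Suc n\<close>; \<open>Suc\<close> avoids division by zero.\<close>
  define W where "W n = (\<Union>(u, v)\<in>{(u, v). v - u < 1 / Suc n \<and> q * (v - u) < f v - f u}. {u<..<v})" for n
  have "steep f q = (\<Inter>n. W n)"
  proof (rule set_eqI, rule iffI)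
    fix x assume "x \<in> steep f q"
    show "x \<in> (\<Inter>n. W n)"
    proof (rule INT_I)
      fix n
      have "1 / real (Suc n) > 0" by simp
      then obtain u v where "u < x" "x < v" "v - u < 1 / Suc n" "q * (v - u) < f v - f u"
        using \<open>x \<in> steep f q\<close> unfolding steep_def by blast
      then show "x \<in> W n" by (auto simp: W_def)
    qed
  next
    fix x assume x: "x \<in> (\<Inter>n. W n)"
    have "\<exists>u v. u < x \<and> x < v \<and> v - u < d \<and> q * (v - u) < f v - f u" if "d > 0" for d
    proof -
      obtain n where n: "1 / real (Suc n) < d"
        using \<open>d > 0\<close> nat_approx_posE by blast
      have "x \<in> W n" using x by blast
      then obtain u v where "u < x" "x < v" "v - u < 1 / real (Suc n)" "q * (v - u) < f v - f u"
        by (auto simp: W_def)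
      with n show ?thesis by (intro exI[of _ u] exI[of _ v]) linarith
    qed
    then show "x \<in> steep f q" by (simp add: steep_def)
  qed
  moreover have "open (W n)" for n by (auto simp: W_def)
  ultimately show ?thesis by (simp add: borel_open)
qed

text \<open>All short chords around \<open>x\<close> have slope at most \<open>q\<close>. By
  continuity one end may be moved to \<open>x\<close> itself, which bounds the difference quotients
  on each side.\<close>

lemma steep_eventually_le:
  assumes "isCont f x" "x \<notin> steep f q"
  shows "\<forall>\<^sub>F y in at x. (f y - f x) / (y - x) \<le> q"
proof -
  obtain d where d: "d > 0" "\<And>u v. u < x \<Longrightarrow> x < v \<Longrightarrow> v - u < d \<Longrightarrow> f v - f u \<le> q * (v - u)"
    using assms(2) by (force simp: steep_def not_less)
  have lim: "(f \<longlongrightarrow> f x) (at_left x)" "(f \<longlongrightarrow> f x) (at_right x)"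
    using assms(1) by (auto simp: isCont_def filterlim_at_split)
  have right: "f v - f x \<le> q * (v - x)" if v: "x < v" "v - x < d" for v
  proof (rule tendsto_le[of "at_left x"])
    show "((\<lambda>u. f v - f u) \<longlongrightarrow> f v - f x) (at_left x)"
         "((\<lambda>u. q * (v - u)) \<longlongrightarrow> q * (v - x)) (at_left x)"
      by (intro tendsto_intros lim)+
    show "\<forall>\<^sub>F u in at_left x. f v - f u \<le> q * (v - u)"
      unfolding eventually_at_left_field using v d(2)
      by (intro exI[of _ "v - d"]) auto
  qed simp
  have left: "f x - f u \<le> q * (x - u)" if u: "u < x" "x - u < d" for u
  proof (rule tendsto_le[of "at_right x"])
    show "((\<lambda>v. f v - f u) \<longlongrightarrow> f x - f u) (at_right x)"
         "((\<lambda>v. q * (v - u)) \<longlongrightarrow> q * (x - u)) (at_right x)"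
      by (intro tendsto_intros lim)+
    show "\<forall>\<^sub>F v in at_right x. f v - f u \<le> q * (v - u)"
      unfolding eventually_at_right_field using u d(2)
      by (intro exI[of _ "u + d"]) auto
  qed simp
  show ?thesis
    unfolding eventually_at
  proof (intro exI conjI ballI impI)
    show "d > 0" by fact
    fix y assume y: "y \<noteq> x \<and> dist y x < d"
    show "(f y - f x) / (y - x) \<le> q"
    proof (cases "x < y")
      case True
      then show ?thesis using right[of y] y by (simp add: dist_real_def field_simps)
    next
      case False
      then show ?thesis using left[of y] y by (simp add: dist_real_def field_simps)
    qed
  qed
qed

text \<open>The limit is the infimum of the eventual upper bounds. Rational pairs suffice, so that
  countably many exceptional sets will do later.\<close>

lemma tendsto_real_of_pinching:
  fixes s :: "'a \<Rightarrow> real"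
  assumes F: "F \<noteq> bot"
    and bdd: "\<forall>\<^sub>F y in F. s y \<le> B" "\<forall>\<^sub>F y in F. - B \<le> s y"
    and pinch: "\<And>p q. p \<in> \<rat> \<Longrightarrow> q \<in> \<rat> \<Longrightarrow> p < q \<Longrightarrow>
      (\<forall>\<^sub>F y in F. s y \<le> q) \<or> (\<forall>\<^sub>F y in F. p \<le> s y)"
  shows "\<exists>L. (s \<longlongrightarrow> L) F"
proof -
  define A where "A = {q. \<forall>\<^sub>F y in F. s y \<le> q}"
  have ne: "B \<in> A" using bdd by (simp add: A_def)
  have lb: "- B \<le> q" if "q \<in> A" for q
  proof -
    have "\<forall>\<^sub>F y in F. - B \<le> q"
      using bdd(2) that[unfolded A_def, simplified] by eventually_elim linarith
    then show ?thesis using F by (simp add: eventually_const)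
  qed
  have bb: "bdd_below A" using lb by (rule bdd_belowI)
  have "(s \<longlongrightarrow> Inf A) F"
  proof (rule order_tendstoI)
    fix c assume "Inf A < c"
    then obtain q where "q \<in> A" "q < c" using ne bb cInf_less_iff by blast
    then show "\<forall>\<^sub>F y in F. s y < c" by (auto simp: A_def elim: eventually_mono)
  next
    fix c assume "c < Inf A"
    \<comment> \<open>Since \<open>q\<close> below the infimum is not an eventual upper bound, the
      alternative makes \<open>p\<close> an eventual lower bound above \<open>c\<close>.\<close>
    obtain p where p: "p \<in> \<rat>" "c < p" "p < Inf A" using Rats_dense_in_real[OF \<open>c < Inf A\<close>] by blast
    obtain q where q: "q \<in> \<rat>" "p < q" "q < Inf A" using Rats_dense_in_real[OF \<open>p < Inf A\<close>] by blast
    have "q \<notin> A" using q(3) cInf_lower[OF _ bb] by (meson not_le)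
    then have "\<forall>\<^sub>F y in F. p \<le> s y" using pinch[OF p(1) q(1,2)] by (auto simp: A_def)
    then show "\<forall>\<^sub>F y in F. c < s y" by eventually_elim (use p(2) in linarith)
  qed
  then show ?thesis ..
qed

text \<open>Outer regularity gives an open set of small excess; intersecting it with
  \<open>W\<close> makes its measure finite.\<close>

lemma open_superset_lmeasurable:
  fixes E W :: "real set"
  assumes E: "E \<in> sets lebesgue" "E \<subseteq> W" and W: "open W" "W \<in> lmeasurable" and "e > 0"
  obtains U where "open U" "E \<subseteq> U" "U \<subseteq> W" "U \<in> lmeasurable"
    "measure lebesgue (U - E) < e" "measure lebesgue U < measure lebesgue E + e"
proof -
  obtain T where T: "open T" "E \<subseteq> T" "T - E \<in> lmeasurable" "emeasure lebesgue (T - E) < ennreal e"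
    using sets_lebesgue_outer_open[OF E(1) \<open>e > 0\<close>] by blast
  define U where "U = T \<inter> W"
  have U: "open U" "E \<subseteq> U" "U \<subseteq> W" using T W E by (auto simp: U_def)
  have lm: "U \<in> lmeasurable"
    using fmeasurableI2[OF W(2) U(3)] U(1) by auto
  have Elm: "E \<in> lmeasurable" using fmeasurableI2[OF W(2) E(2,1)] .
  have "measure lebesgue (T - E) < e"
    using T(3,4) \<open>e > 0\<close> by (simp add: emeasure_eq_measure2 ennreal_less_iff)
  moreover have "measure lebesgue (U - E) \<le> measure lebesgue (T - E)"
    using T(3) lm E(1) by (intro measure_mono_fmeasurable) (auto simp: U_def)
  ultimately have less: "measure lebesgue (U - E) < e" by linarith
  moreover have "measure lebesgue U = measure lebesgue E + measure lebesgue (U - E)"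
    using measurable_measure_Diff[OF lm E(1) U(2)] by simp
  ultimately show ?thesis using that U lm by auto
qed

text \<open>A finite disjoint family \<open>P\<close> of short intervals of slope below \<open>p\<close> covers most of the set \<open>E\<close>, and a
  finite disjoint family \<open>D\<close> of intervals of slope above \<open>q\<close>, each inside a member of \<open>P\<close>, still
  covers most of \<open>E\<close>. The gaps have small total length, so by absolute continuity the total
  increments of \<open>f\<close> over \<open>P\<close> and over \<open>D\<close> almost agree, which forces \<open>q |E| \<le> p |E|\<close>.\<close>

lemma negligible_steep_both:
  assumes ac: "absolutely_continuous_curve {0..1} f" and "p < q"
  shows "negligible ({0<..<1} \<inter> steep f q \<inter> steep (\<lambda>x. - f x) (- p))"
proof (rule ccontr)
  define E where "E = {0<..<1} \<inter> steep f q \<inter> steep (\<lambda>x. - f x) (- p)"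
  define m where "m = measure lebesgue E"
  assume "\<not> negligible ({0<..<1} \<inter> steep f q \<inter> steep (\<lambda>x. - f x) (- p))"
  then have nn: "\<not> negligible E" by (simp add: E_def)
  have "E \<in> sets borel"
    unfolding E_def by (intro sets.Int borel_steep) simp_all
  then have Eb: "E \<in> sets lebesgue" by (simp add: sets_completionI_sets)
  have E01: "E \<subseteq> {0<..<1}" by (auto simp: E_def)
  have "E \<in> lmeasurable"
    by (rule fmeasurableI2[OF _ E01 Eb]) simp
  then have m: "m > 0"
    using nn zero_less_measure_iff[of lebesgue E] unfolding m_def negligible_iff_measure by blast
  \<comment> \<open>The estimates end in \<open>(q - p) * lD \<le> 2 * \<epsilon>\<close>, that is
    \<open>lD \<le> m / 4\<close>, against \<open>lD > m / 2\<close>.\<close>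
  define \<epsilon> where "\<epsilon> = (q - p) * m / 8"
  have "\<epsilon> > 0" using m \<open>p < q\<close> by (simp add: \<epsilon>_def)
  obtain \<delta> where \<delta>: "\<delta> > 0"
    "\<forall>D. D division_of \<Union>D \<and> \<Union>D \<subseteq> {0..1} \<and> (\<Sum>K\<in>D. Sup K - Inf K) < \<delta> \<longrightarrow>
      (\<Sum>K\<in>D. norm (f (Sup K) - f (Inf K))) < \<epsilon>"
    using absolutely_continuous_curveD[OF ac \<open>\<epsilon> > 0\<close>] by (elim exE conjE) (rule that)
  \<comment> \<open>The gaps will have total length below \<open>4 * \<eta> = M\<close>. The three
    bounds make absolute continuity apply to the gaps, keep \<open>D\<close> longer than
    \<open>m / 2\<close>, and keep \<open>p * lR\<close> below \<epsilon>.\<close>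
  define M where "M = min \<delta> (min (m / 2) (\<epsilon> / (\<bar>p\<bar> + 1)))"
  have M: "M > 0" "M \<le> \<delta>" "M \<le> m / 2" "M \<le> \<epsilon> / (\<bar>p\<bar> + 1)"
  proof -
    show "M > 0" using \<delta>(1) m \<open>\<epsilon> > 0\<close> by (simp add: M_def add_nonneg_pos)
    show "M \<le> \<delta>" "M \<le> m / 2" "M \<le> \<epsilon> / (\<bar>p\<bar> + 1)"
      unfolding M_def by linarith+
  qed
  define \<eta> where "\<eta> = M / 4"
  have \<eta>: "\<eta> > 0" "4 * \<eta> \<le> \<delta>" "4 * \<eta> \<le> m / 2" "4 * \<eta> \<le> \<epsilon> / (\<bar>p\<bar> + 1)"
    using M by (simp_all add: \<eta>_def)
  obtain U where U: "open U" "E \<subseteq> U" "U \<subseteq> {0<..<1}" "U \<in> lmeasurable"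
    "measure lebesgue (U - E) < \<eta>" "measure lebesgue U < measure lebesgue E + \<eta>"
    by (rule open_superset_lmeasurable[OF Eb E01 _ _ \<eta>(1)]) (simp, simp, rule that)
  \<comment> \<open>A chord of \<open>- f\<close> with slope above \<open>- p\<close> is a chord of
    \<open>f\<close> with slope below \<open>p\<close>.\<close>
  have fineP: "\<exists>u v. u < v \<and> x \<in> {u..v} \<and> v - u < d \<and> f v - f u < p * (v - u)"
    if x: "x \<in> E" and "d > 0" for x d
  proof -
    obtain u v where "u < x" "x < v" "v - u < d" "- p * (v - u) < - f v - - f u"
      using x \<open>d > 0\<close> unfolding E_def steep_def by blast
    then show ?thesis by (intro exI[of _ u] exI[of _ v]) auto
  qed
  obtain P where P: "P division_of \<Union>P" "disjoint P" "\<Union>P \<subseteq> U"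
    "\<And>K. K \<in> P \<Longrightarrow> \<exists>u v. u < v \<and> K = {u..v} \<and> f v - f u < p * (v - u)"
    "measure lebesgue E - \<eta> < (\<Sum>K\<in>P. Sup K - Inf K)"
    "(\<Sum>K\<in>P. Sup K - Inf K) \<le> measure lebesgue U"
    by (rule vitali_finite_selection[OF Eb U(1,4,2) _ \<eta>(1),
          where Q = "\<lambda>u v. f v - f u < p * (v - u)"])
      (erule (1) fineP, rule that)
  \<comment> \<open>Passing to interiors loses only end points, and leaves room around each point
    for the second selection inside a member of \<open>P\<close>.\<close>
  define V where "V = (\<Union>K\<in>P. interior K)"
  have "open V" by (auto simp: V_def)
  have "V \<subseteq> \<Union>P" using interior_subset by (auto simp: V_def)
  have Vlm: "V \<in> lmeasurable"
    by (rule fmeasurableI2[OF U(4)]) (use \<open>open V\<close> \<open>V \<subseteq> \<Union>P\<close> P(3) in auto)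
  have "measure lebesgue V = (\<Sum>K\<in>P. measure lebesgue (interior K))"
    unfolding V_def
  proof (rule measure_UNION')
    show "finite P" using P(1) by blast
    show "interior K \<in> lmeasurable" if "K \<in> P" for K
      using P(4)[OF that] by auto
    show "pairwise (\<lambda>i j. disjnt (interior i) (interior j)) P"
      using division_ofD(5)[OF P(1)] by (auto simp: pairwise_def disjnt_def)
  qed
  also have "\<dots> = (\<Sum>K\<in>P. Sup K - Inf K)"
    using P(4) by (intro sum.cong) force+
  finally have mV: "measure lebesgue V = (\<Sum>K\<in>P. Sup K - Inf K)" .
  define E' where "E' = E \<inter> V"
  have E'b: "E' \<in> sets lebesgue" unfolding E'_def
    by (rule sets.Int[OF Eb]) (simp add: \<open>open V\<close> borel_open sets_completionI_sets)
  have "measure lebesgue V = measure lebesgue E' + measure lebesgue (V - E')"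
    using measurable_measure_Diff[OF Vlm E'b] by (simp add: E'_def)
  moreover have "measure lebesgue (V - E') \<le> measure lebesgue (U - E)"
    using U(4) Eb Vlm E'b \<open>V \<subseteq> \<Union>P\<close> P(3)
    by (intro measure_mono_fmeasurable) (auto simp: E'_def fmeasurableD intro!: fmeasurable_Diff)
  \<comment> \<open>One \<eta> is lost in selecting \<open>P\<close>, the other is the excess of
    \<open>U\<close> over \<open>E\<close>.\<close>
  ultimately have mE': "measure lebesgue E' > m - 2 * \<eta>"
    using mV P(5) U(5) unfolding m_def by linarith
  \<comment> \<open>The last conjunct forces the second family to refine \<open>P\<close>.\<close>
  have fineQ: "\<exists>u v. u < v \<and> x \<in> {u..v} \<and> v - u < d \<and> q * (v - u) < f v - f u \<and> (\<exists>K\<in>P. {u..v} \<subseteq> K)"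
    if x: "x \<in> E'" and "d > 0" for x d
  proof -
    obtain K where K: "K \<in> P" "x \<in> interior K" using x by (auto simp: E'_def V_def)
    then obtain e where e: "e > 0" "ball x e \<subseteq> K" by (auto simp: mem_interior)
    have "min d e > 0" using \<open>d > 0\<close> e by simp
    then obtain u v where uv: "u < x" "x < v" "v - u < min d e" "q * (v - u) < f v - f u"
      using x unfolding E'_def E_def steep_def by blast
    have "{u..v} \<subseteq> K"
      using uv e(2) by (force simp: ball_def dist_real_def)
    then show ?thesis using uv K by (intro exI[of _ u] exI[of _ v]) auto
  qed
  obtain D where D: "D division_of \<Union>D" "disjoint D" "\<Union>D \<subseteq> V"
    "\<And>K. K \<in> D \<Longrightarrow> \<exists>u v. u < v \<and> K = {u..v} \<and> q * (v - u) < f v - f u \<and> (\<exists>K\<in>P. {u..v} \<subseteq> K)"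
    "measure lebesgue E' - \<eta> < (\<Sum>K\<in>D. Sup K - Inf K)"
    by (rule vitali_finite_selection[OF E'b \<open>open V\<close> Vlm _ _ \<eta>(1), where
          Q = "\<lambda>u v. q * (v - u) < f v - f u \<and> (\<exists>K\<in>P. {u..v} \<subseteq> K)"])
      (simp add: E'_def, erule (1) fineQ, rule that)
  obtain R where R: "R division_of \<Union>R" "\<Union>R \<subseteq> \<Union>P"
    and split: "\<And>h :: real \<Rightarrow> real. (\<Sum>K\<in>P. h (Sup K) - h (Inf K)) =
      (\<Sum>K\<in>D. h (Sup K) - h (Inf K)) + (\<Sum>K\<in>R. h (Sup K) - h (Inf K))"
  proof (rule refinement_gaps[OF P(1,2) D(1)])
    show "\<exists>K\<in>P. L \<subseteq> K" if "L \<in> D" for L using D(4)[OF that] by blast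
  qed (rule that)
  define lP lD lR where "lP = (\<Sum>K\<in>P. Sup K - Inf K)" and "lD = (\<Sum>K\<in>D. Sup K - Inf K)"
    and "lR = (\<Sum>K\<in>R. Sup K - Inf K)"
  define fP fD fR where "fP = (\<Sum>K\<in>P. f (Sup K) - f (Inf K))" and "fD = (\<Sum>K\<in>D. f (Sup K) - f (Inf K))"
    and "fR = (\<Sum>K\<in>R. f (Sup K) - f (Inf K))"
  have l: "lP = lD + lR" unfolding lP_def lD_def lR_def using split[of "\<lambda>x. x"] .
  have f: "fP = fD + fR" unfolding fP_def fD_def fR_def using split[of f] .
  \<comment> \<open>Selecting \<open>D\<close> costs a third \<eta>; with the excess in
    \<open>lP\<close> this bounds the gaps by \<open>4 * \<eta>\<close>.\<close>
  have "lD > m - 3 * \<eta>" using D(5) mE' by (simp add: lD_def)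
  moreover have "lP < m + \<eta>" using P(6) U(6) by (simp add: lP_def m_def)
  ultimately have "lR < 4 * \<eta>" "lD > m / 2" using l \<eta> by linarith+
  have "lR \<ge> 0" unfolding lR_def
  proof (rule sum_nonneg)
    fix K assume "K \<in> R"
    then obtain a b where "a \<le> b" "K = {a..b}"
        by (rule division_of_realE[OF R(1)])
    then show "0 \<le> Sup K - Inf K" by simp
  qed
  have "\<bar>fR\<bar> \<le> (\<Sum>K\<in>R. norm (f (Sup K) - f (Inf K)))"
    unfolding fR_def real_norm_def by (rule sum_abs)
  moreover have "(\<Sum>K\<in>R. norm (f (Sup K) - f (Inf K))) < \<epsilon>"
  proof (intro \<delta>(2)[rule_format] conjI R(1))
    show "\<Union>R \<subseteq> {0..1}"
      by (rule order_trans[OF R(2) order_trans[OF P(3) order_trans[OF U(3)]]]) auto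
    show "(\<Sum>K\<in>R. Sup K - Inf K) < \<delta>"
      using \<open>lR < 4 * \<eta>\<close> \<eta>(2) unfolding lR_def by linarith
  qed
  ultimately have fR: "\<bar>fR\<bar> < \<epsilon>" by linarith
  have "fP \<le> p * lP" unfolding fP_def lP_def sum_distrib_left
    using P(4) by (intro sum_mono) force
  moreover have "q * lD \<le> fD" unfolding fD_def lD_def sum_distrib_left
    using D(4) by (intro sum_mono) force
  \<comment> \<open>Substitute \<open>fP = fD + fR\<close> and \<open>lP = lD + lR\<close> into the
    two slope estimates and bound \<open>- fR\<close> by \<epsilon>.\<close>
  ultimately have "(q - p) * lD \<le> p * lR + \<epsilon>"
    using fR f l by (simp add: algebra_simps)
  also have "p * lR \<le> (\<bar>p\<bar> + 1) * (\<epsilon> / (\<bar>p\<bar> + 1))"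
    using \<open>lR \<ge> 0\<close> \<open>lR < 4 * \<eta>\<close> \<eta>(4) by (intro mult_mono) auto
  also have "\<dots> = \<epsilon>" by simp
  finally have "(q - p) * lD \<le> (q - p) * (m / 4)" by (simp add: \<epsilon>_def mult.commute)
  then have "lD \<le> m / 4"
    using \<open>p < q\<close> mult_le_cancel_left_pos[of "q - p" lD "m / 4"] by linarith
  with \<open>lD > m / 2\<close> m show False by linarith
qed

text \<open>Negligibility is local. On a set of length below \<delta>, increments over any division
  sum to less than 1, whereas a set of positive measure there could be half covered by disjoint
  intervals of arbitrarily large slope.\<close>

lemma negligible_steep_unbounded:
  assumes ac: "absolutely_continuous_curve {0..1} f"
  shows "negligible ({0<..<1} \<inter> (\<Inter>n. steep f (real n)))"
proof (rule locally_negligible_alt[THEN iffD2], rule ballI)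
  fix x assume x: "x \<in> {0<..<1} \<inter> (\<Inter>n. steep f (real n))" (is "x \<in> ?S")
  obtain \<delta> where \<delta>: "\<delta> > 0"
    "\<forall>D. D division_of \<Union>D \<and> \<Union>D \<subseteq> {0..1} \<and> (\<Sum>K\<in>D. Sup K - Inf K) < \<delta> \<longrightarrow>
      (\<Sum>K\<in>D. norm (f (Sup K) - f (Inf K))) < 1"
    using absolutely_continuous_curveD[OF ac zero_less_one] by (elim exE conjE) (rule that)
  \<comment> \<open>The ball has length \<open>2 * \<delta> / 3\<close>, so every division inside
    \<open>U\<close> meets the length condition.\<close>
  define U where "U = {0<..<1} \<inter> ball x (\<delta> / 3)"
  define E where "E = ?S \<inter> U"
  have U: "open U" "U \<in> lmeasurable" by (auto simp: U_def)
  have "E \<in> sets borel"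
    unfolding E_def U_def by (intro sets.Int sets.countable_INT'' borel_steep) simp_all
  then have Eb: "E \<in> sets lebesgue" by (simp add: sets_completionI_sets)
  have Elm: "E \<in> lmeasurable" by (rule fmeasurableI2[OF U(2)]) (use Eb in \<open>auto simp: E_def\<close>)
  have "measure lebesgue U \<le> measure lebesgue (ball x (\<delta> / 3))"
    using U by (intro measure_mono_fmeasurable) (auto simp: U_def)
  also have "\<dots> < \<delta>"
    using \<delta>(1) by (simp add: ball_eq_greaterThanLessThan)
  finally have mU: "measure lebesgue U < \<delta>" .
  have "negligible E"
  proof (rule ccontr)
    assume "\<not> negligible E"
    then have m: "measure lebesgue E > 0" (is "?m > 0")
      using Elm zero_less_measure_iff[of lebesgue E] unfolding negligible_iff_measure by blast
    \<comment> \<open>Slope above \<open>n\<close> on total length above \<open>?m / 2\<close> gives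
      increments of at least 1.\<close>
    then obtain n :: nat where n: "2 / ?m < real n" using reals_Archimedean2 by blast
    have fine: "\<exists>u v. u < v \<and> y \<in> {u..v} \<and> v - u < d \<and> real n * (v - u) < f v - f u"
      if y: "y \<in> E" and "d > 0" for y d
    proof -
      obtain u v where "u < y" "y < v" "v - u < d" "real n * (v - u) < f v - f u"
        using y \<open>d > 0\<close> unfolding E_def steep_def by blast
      then show ?thesis by (intro exI[of _ u] exI[of _ v]) auto
    qed
    have "?m / 2 > 0" "E \<subseteq> U" using m by (auto simp: E_def)
    obtain D where D: "D division_of \<Union>D" "disjoint D" "\<Union>D \<subseteq> U"
      "\<And>K. K \<in> D \<Longrightarrow> \<exists>u v. u < v \<and> K = {u..v} \<and> real n * (v - u) < f v - f u"
      "?m - ?m / 2 < (\<Sum>K\<in>D. Sup K - Inf K)"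
      "(\<Sum>K\<in>D. Sup K - Inf K) \<le> measure lebesgue U"
      by (rule vitali_finite_selection[OF Eb U \<open>E \<subseteq> U\<close> _ \<open>?m / 2 > 0\<close>,
            where Q = "\<lambda>u v. real n * (v - u) < f v - f u"])
        (erule (1) fine, rule that)
    have "1 \<le> real n * (?m / 2)" using n m by (simp add: field_simps)
    also have "\<dots> \<le> real n * (\<Sum>K\<in>D. Sup K - Inf K)" using D(5) by (intro mult_left_mono) auto
    also have "\<dots> \<le> (\<Sum>K\<in>D. norm (f (Sup K) - f (Inf K)))"
      unfolding sum_distrib_left using D(4) by (intro sum_mono) force
    also have "\<dots> < 1"
    proof (intro \<delta>(2)[rule_format] conjI D(1))
      have "U \<subseteq> {0..1}" by (auto simp: U_def)
      then show "\<Union>D \<subseteq> {0..1}" using D(3) by (rule order_trans[rotated])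
      show "(\<Sum>K\<in>D. Sup K - Inf K) < \<delta>" using D(6) mU by linarith
    qed
    finally show False by simp
  qed
  moreover have "openin (top_of_set ?S) E" unfolding E_def using U(1) by (auto simp: openin_open)
  moreover have "x \<in> E" using x \<delta>(1) by (auto simp: E_def U_def)
  ultimately show "\<exists>U. openin (top_of_set ?S) U \<and> x \<in> U \<and> negligible U" by blast
qed

lemma absolutely_continuous_uminus:
  "absolutely_continuous_curve I f \<Longrightarrow> absolutely_continuous_curve I (\<lambda>x. - f x)"
  by (rule absolutely_continuous_curve_bounded_by[where \<mu> = f and L = 1]) (auto simp: norm_minus_commute)

text \<open>Off the null set, the difference quotients are eventually bounded on both sides and
  cannot oscillate across any rational gap, so they converge.\<close>

lemma absolutely_continuous_real_differentiable:
  fixes f :: "real \<Rightarrow> real"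
  assumes ac: "absolutely_continuous_curve {0..1} f"
  obtains N where "negligible N" "\<And>t. t \<in> {0<..<1} - N \<Longrightarrow> \<exists>d. (f has_real_derivative d) (at t)"
proof -
  let ?g = "\<lambda>x. - f x"
  \<comment> \<open>The first two sets are the points of unbounded upper and lower slopes; the last
    union collects oscillation across a rational pair \<open>p < q\<close>.\<close>
  define N where "N = {0<..<1} \<inter> (\<Inter>n. steep f (real n)) \<union> {0<..<1} \<inter> (\<Inter>n. steep ?g (real n))
    \<union> (\<Union>(p, q)\<in>{(p, q). p \<in> \<rat> \<and> q \<in> \<rat> \<and> p < q}. {0<..<1} \<inter> steep f q \<inter> steep ?g (- p))"
  have acg: "absolutely_continuous_curve {0..1} ?g" using ac by (rule absolutely_continuous_uminus)
  have "countable {(p :: real, q). p \<in> \<rat> \<and> q \<in> \<rat> \<and> p < q}"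
    by (rule countable_subset[OF _ countable_SIGMA[OF countable_rat, of "\<lambda>_. \<rat>"]])
       (auto simp: countable_rat)
  then have neg: "negligible N"
    unfolding N_def using negligible_steep_both[OF ac]
    by (intro negligible_Un negligible_steep_unbounded ac acg negligible_countable_Union) auto
  have "\<exists>d. (f has_real_derivative d) (at t)" if t: "t \<in> {0<..<1} - N" for t
  proof -
    have cont: "isCont f t" "isCont ?g t"
      using absolutely_continuous_imp_isCont[OF ac] t by auto
    obtain k l where kl: "t \<notin> steep f (real k)" "t \<notin> steep ?g (real l)"
      using t by (auto simp: N_def)
    let ?s = "\<lambda>y. (f y - f t) / (y - t)"
    have s: "(- f y - - f t) / (y - t) = - ?s y" for y
    proof -
      have "- f y - - f t = - (f y - f t)" by simp
      then show ?thesis by (simp only: minus_divide_left)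
    qed
    have up: "\<forall>\<^sub>F y in at t. ?s y \<le> q" if "t \<notin> steep f q" for q
      using steep_eventually_le[OF cont(1) that] .
    have low: "\<forall>\<^sub>F y in at t. - q \<le> ?s y" if "t \<notin> steep ?g q" for q
      using steep_eventually_le[OF cont(2) that] unfolding s by eventually_elim linarith
    have "\<exists>L. (?s \<longlongrightarrow> L) (at t)"
    proof (rule tendsto_real_of_pinching)
      show "\<forall>\<^sub>F y in at t. ?s y \<le> real (max k l)"
        using up[OF kl(1)] by eventually_elim linarith
      show "\<forall>\<^sub>F y in at t. - real (max k l) \<le> ?s y"
        using low[OF kl(2)] by eventually_elim linarith
      show "(\<forall>\<^sub>F y in at t. ?s y \<le> q) \<or> (\<forall>\<^sub>F y in at t. p \<le> ?s y)"
        if "p \<in> \<rat>" "q \<in> \<rat>" "p < q" for p q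
        using that t up[of q] low[of "- p"] by (auto simp: N_def)
    qed simp
    then show ?thesis by (simp add: has_field_derivative_iff)
  qed
  with neg show ?thesis by (rule that)
qed

text \<open>Each coordinate is dominated by the curve, and the finitely many exceptional null sets
  are united.\<close>

lemma absolutely_continuous_differentiable:
  fixes \<mu> :: "real \<Rightarrow> 'a::euclidean_space"
  assumes ac: "absolutely_continuous_curve {0..1} \<mu>"
  obtains N where "negligible N"
    "\<And>t. t \<in> {0<..<1} - N \<Longrightarrow> \<exists>d. (\<mu> has_vector_derivative d) (at t)"
proof -
  have comp: "absolutely_continuous_curve {0..1} (\<lambda>t. \<mu> t \<bullet> b)" if "b \<in> Basis" for b
    by (rule absolutely_continuous_curve_bounded_by[OF ac, of 1])
       (use that in \<open>simp_all add: Basis_le_norm flip: inner_diff_left\<close>)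
  have ex: "\<exists>N. negligible N \<and>
      (\<forall>t\<in>{0<..<1} - N. \<exists>d. ((\<lambda>t. \<mu> t \<bullet> b) has_real_derivative d) (at t))" if "b \<in> Basis" for b
    by (rule absolutely_continuous_real_differentiable[OF comp[OF that]]) blast
  obtain N where N: "\<And>b. b \<in> Basis \<Longrightarrow> negligible (N b)"
    "\<And>b t. b \<in> Basis \<Longrightarrow> t \<in> {0<..<1} - N b \<Longrightarrow> \<exists>d. ((\<lambda>t. \<mu> t \<bullet> b) has_real_derivative d) (at t)"
  proof (rule that)
    fix b :: 'a assume "b \<in> Basis"
    note some = someI_ex[OF ex[OF this]]
    show "negligible (SOME N. negligible N \<and>
      (\<forall>t\<in>{0<..<1} - N. \<exists>d. ((\<lambda>t. \<mu> t \<bullet> b) has_real_derivative d) (at t)))"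
      using some by (rule conjunct1)
    fix t assume "t \<in> {0<..<1} - (SOME N. negligible N \<and>
      (\<forall>t\<in>{0<..<1} - N. \<exists>d. ((\<lambda>t. \<mu> t \<bullet> b) has_real_derivative d) (at t)))"
    with some show "\<exists>d. ((\<lambda>t. \<mu> t \<bullet> b) has_real_derivative d) (at t)"
      by (elim conjE) (rule bspec)
  qed
  have neg: "negligible (\<Union>b\<in>Basis. N b)" using N(1) by (intro negligible_Union) auto
  have "\<exists>d. (\<mu> has_vector_derivative d) (at t)" if t: "t \<in> {0<..<1} - (\<Union>b\<in>Basis. N b)" for t
  proof -
    define d where "d b = deriv (\<lambda>t. \<mu> t \<bullet> b) t" for b
    have d: "((\<lambda>t. \<mu> t \<bullet> b) has_real_derivative d b) (at t)" if "b \<in> Basis" for b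
    proof -
      obtain c where "((\<lambda>t. \<mu> t \<bullet> b) has_real_derivative c) (at t)"
        using N(2)[OF \<open>b \<in> Basis\<close>, of t] t \<open>b \<in> Basis\<close> by auto
      then show ?thesis unfolding d_def by (simp add: DERIV_imp_deriv)
    qed
    have "(\<mu> has_vector_derivative (\<Sum>b\<in>Basis. d b *\<^sub>R b)) (at t)"
      unfolding has_vector_derivative_def has_derivative_componentwise_within[of \<mu>]
    proof
      fix b :: 'a assume b: "b \<in> Basis"
      show "((\<lambda>t. \<mu> t \<bullet> b) has_derivative (\<lambda>x. x *\<^sub>R (\<Sum>b\<in>Basis. d b *\<^sub>R b) \<bullet> b)) (at t)"
        using d[OF b] b by (simp add: has_field_derivative_def mult_commute_abs)
    qed
    then show ?thesis ..
  qed
  with neg show ?thesis by (rule that)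
qed

section \<open>Continuous selections of finitely many affine maps\<close>

text \<open>Along a segment, the times at which a given map is active form closed sets covering
  \<open>{0..1}\<close>. On each of them the restriction is Lipschitz with a common constant, and
  finitely many such closed pieces glue.\<close>

lemma lipschitz_of_affine_selection:
  fixes G :: "real ^ 'm \<Rightarrow> real ^ 'n" and F :: "((real ^ 'm ^ 'n) \<times> (real ^ 'n)) set"
  assumes cont: "continuous_on UNIV G" and fin: "finite F"
    and sel: "\<And>\<theta>. \<exists>p\<in>F. G \<theta> = fst p *v \<theta> + snd p"
  obtains L where "L-lipschitz_on UNIV G"
proof -
  \<comment> \<open>The sum is a convenient common bound for the operator norms of all linear
    parts.\<close>
  define L where "L = (\<Sum>p\<in>F. onorm ((*v) (fst p)))"
  have bl: "bounded_linear ((*v) (M :: real ^ 'm ^ 'n))" for M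
    by (rule matrix_vector_mul_bounded_linear)
  have "L \<ge> 0" unfolding L_def by (intro sum_nonneg onorm_pos_le bl)
  have L: "norm (fst p *v v) \<le> L * norm v" if "p \<in> F" for p v
  proof -
    have "onorm ((*v) (fst p)) \<le> L"
      unfolding L_def by (rule member_le_sum[OF that _ fin]) (rule onorm_pos_le[OF bl])
    from mult_right_mono[OF this norm_ge_zero] show ?thesis
      by (rule order_trans[OF onorm[OF bl]])
  qed
  have "dist (G a) (G b) \<le> L * dist a b" for a b
  proof -
    define \<gamma> where "\<gamma> s = a + s *\<^sub>R (b - a)" for s :: real
    define U where "U p = {s. G (\<gamma> s) = fst p *v \<gamma> s + snd p}" for p
    have c\<gamma>: "continuous_on UNIV \<gamma>" unfolding \<gamma>_def by (intro continuous_intros)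
    have "(L * norm (b - a))-lipschitz_on {0..1} (\<lambda>s. G (\<gamma> s))"
    proof (rule lipschitz_on_closed_Union[where I = F and U = U])
      show "closed (U p)" for p
        unfolding U_def
      proof (rule closed_Collect_eq)
        show "continuous_on UNIV (\<lambda>s. G (\<gamma> s))"
          using continuous_on_compose2[OF cont c\<gamma>] by simp
        show "continuous_on UNIV (\<lambda>s. fst p *v \<gamma> s + snd p)"
          by (intro continuous_intros bounded_linear.continuous_on[OF bl] c\<gamma>)
      qed
      show "{0..1} \<subseteq> (\<Union>i\<in>F. U i)" using sel by (auto simp: U_def)
      show "0 \<le> L * norm (b - a)" using \<open>L \<ge> 0\<close> by simp
      fix p assume "p \<in> F"
      show "(L * norm (b - a))-lipschitz_on (U p) (\<lambda>s. G (\<gamma> s))"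
      proof (rule lipschitz_onI)
        \<comment> \<open>\<open>U p\<close> may be disconnected: the affine formula is evaluated
          only at \<open>s\<close> and \<open>t\<close>.\<close>
        fix s t assume st: "s \<in> U p" "t \<in> U p"
        have "\<gamma> s - \<gamma> t = (s - t) *\<^sub>R (b - a)" by (simp add: \<gamma>_def algebra_simps)
        moreover have "G (\<gamma> s) - G (\<gamma> t) = fst p *v (\<gamma> s - \<gamma> t)"
          using st by (simp add: U_def matrix_vector_mult_diff_distrib)
        ultimately show "dist (G (\<gamma> s)) (G (\<gamma> t)) \<le> L * norm (b - a) * dist s t"
          using L[OF \<open>p \<in> F\<close>, of "\<gamma> s - \<gamma> t"] by (simp add: dist_norm ac_simps)
      qed (use \<open>L \<ge> 0\<close> in simp)
    qed (rule fin)
    from lipschitz_onD[OF this, of 0 1] show ?thesis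
      by (simp add: \<gamma>_def dist_norm norm_minus_commute)
  qed
  then have "L-lipschitz_on UNIV G" using \<open>L \<ge> 0\<close> by (intro lipschitz_onI) auto
  then show ?thesis by (rule that)
qed

lemma path_differentiable_of_affine_selection:
  fixes G :: "real ^ 'm \<Rightarrow> real ^ 'n" and F :: "((real ^ 'm ^ 'n) \<times> (real ^ 'n)) set"
  assumes cont: "continuous_on UNIV G" and fin: "finite F"
    and sel: "\<And>\<theta>. \<exists>p\<in>F. G \<theta> = fst p *v \<theta> + snd p"
  shows "path_differentiable G"
  unfolding path_differentiable_def
proof
  obtain L where L: "L-lipschitz_on UNIV G"
    by (rule lipschitz_of_affine_selection[OF cont fin sel])
  then have "L-lipschitz_on (ball x 1) G" for x by (rule lipschitz_on_subset) simp
  then show "locally_lipschitz G"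
    unfolding locally_lipschitz_def by (intro allI exI[of _ 1] conjI exI[of _ L]) simp_all
  \<comment> \<open>All maps agreeing with \<open>G\<close> at the point count, including accidental
    agreements; this makes the graph closed.\<close>
  define J where "J \<theta> = {V. \<exists>c. (V, c) \<in> F \<and> G \<theta> = V *v \<theta> + c}" for \<theta>
  have "conservative_jacobian G J"
    unfolding conservative_jacobian_def
  proof (intro conjI allI impI)
    show "J \<theta> \<noteq> {}" for \<theta> using sel[of \<theta>] by (force simp: J_def)
    have bdd: "bounded (\<Union>y\<in>ball x 1. J y)" for x
    proof (rule finite_imp_bounded)
      have "(\<Union>y\<in>ball x 1. J y) \<subseteq> fst ` F"
      proof
        fix V assume "V \<in> (\<Union>y\<in>ball x 1. J y)"
        then obtain c where "(V, c) \<in> F" by (auto simp: J_def)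
        then show "V \<in> fst ` F" by (rule image_eqI[rotated]) simp
      qed
      then show "finite (\<Union>y\<in>ball x 1. J y)" by (rule finite_subset) (use fin in simp)
    qed
    show "locally_bounded_map J"
      unfolding locally_bounded_map_def by (intro allI exI[of _ 1] conjI bdd) simp
    \<comment> \<open>For each map the set of agreement is closed by continuity, so the graph is a
      finite union of closed products.\<close>
    have "Sigma UNIV J = (\<Union>p\<in>F. {\<theta>. G \<theta> = fst p *v \<theta> + snd p} \<times> {fst p})"
      by (force simp: J_def)
    moreover have "closed {\<theta>. G \<theta> = fst p *v \<theta> + snd p}" for p
      by (intro closed_Collect_eq cont continuous_intros
          bounded_linear.continuous_on[OF matrix_vector_mul_bounded_linear])
    ultimately show "closed (Sigma UNIV J)"
      using fin by (auto intro!: closed_UN closed_Times)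
  next
    fix \<mu> :: "real \<Rightarrow> real ^ 'm" assume ac: "absolutely_continuous_curve {0..1} \<mu>"
    have "absolutely_continuous_curve {0..1} (\<lambda>s. G (\<mu> s))"
      by (rule absolutely_continuous_curve_bounded_by[OF ac lipschitz_on_nonneg[OF L]])
         (use lipschitz_onD[OF L] in \<open>simp add: dist_norm\<close>)
    then obtain N2 where N2: "negligible N2"
      "\<And>t. t \<in> {0<..<1} - N2 \<Longrightarrow> \<exists>e. ((\<lambda>s. G (\<mu> s)) has_vector_derivative e) (at t)"
      by (rule absolutely_continuous_differentiable) (rule that)
    obtain N1 where N1: "negligible N1"
      "\<And>t. t \<in> {0<..<1} - N1 \<Longrightarrow> \<exists>d. (\<mu> has_vector_derivative d) (at t)"
      by (rule absolutely_continuous_differentiable[OF ac]) (rule that)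
    define T where "T p = {t. G (\<mu> t) = fst p *v \<mu> t + snd p}" for p
    \<comment> \<open>Besides non-differentiability, \<open>B\<close> removes the end points, where
      only one-sided derivatives could be hoped for, and the isolated times of each activity
      set.\<close>
    define B where "B = N1 \<union> N2 \<union> {0, 1} \<union> (\<Union>p\<in>F. {t \<in> T p. \<not> t islimpt T p})"
    have "negligible B"
    proof -
      have "countable (\<Union>p\<in>F. {t \<in> T p. \<not> t islimpt T p})"
        using fin by (intro countable_UN countable_isolated_points countable_finite)
      then have "negligible (\<Union>p\<in>F. {t \<in> T p. \<not> t islimpt T p})"
        using countable_imp_null_set_lborel null_sets_completionI negligible_iff_null_sets by blast
      then show ?thesis unfolding B_def using N1(1) N2(1) by (simp add: negligible_Un)
    qed
    have deriv: "\<exists>d. (\<mu> has_vector_derivative d) (at t within {0..1}) \<and>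
        (\<forall>V\<in>J (\<mu> t). ((\<lambda>s. G (\<mu> s)) has_vector_derivative V *v d) (at t within {0..1}))"
      if t: "t \<in> {0..1} - B" for t
    proof -
      have t': "t \<in> {0<..<1} - N1" "t \<in> {0<..<1} - N2" using t by (auto simp: B_def)
      obtain d where d: "(\<mu> has_vector_derivative d) (at t)" using N1(2)[OF t'(1)] by blast
      obtain e where e: "((\<lambda>s. G (\<mu> s)) has_vector_derivative e) (at t)" using N2(2)[OF t'(2)] by blast
      \<comment> \<open>Within \<open>T (V, c)\<close> the image curve coincides with the affine
        image of \<mu>; at an accumulation point the derivative within this set is unique.\<close>
      have "e = V *v d" if V: "V \<in> J (\<mu> t)" for V
      proof -
        obtain c where c: "(V, c) \<in> F" "t \<in> T (V, c)" using V by (auto simp: J_def T_def)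
        then have lim: "t islimpt T (V, c)" using t by (auto simp: B_def)
        have "((\<lambda>s. V *v \<mu> s + c) has_vector_derivative V *v d + 0) (at t within T (V, c))"
          by (intro has_vector_derivative_add has_vector_derivative_const
              bounded_linear.has_vector_derivative[OF matrix_vector_mul_bounded_linear]
              has_vector_derivative_at_within[OF d])
        then have aff: "((\<lambda>s. V *v \<mu> s + c) has_vector_derivative V *v d) (at t within T (V, c))"
          by simp
        have "((\<lambda>s. G (\<mu> s)) has_vector_derivative V *v d) (at t within T (V, c))"
          by (rule has_vector_derivative_transform[OF c(2) _ aff]) (simp add: T_def)
        moreover have "at t within T (V, c) \<noteq> bot"
          using lim by (simp add: trivial_limit_within)
        moreover have "((\<lambda>s. G (\<mu> s)) has_vector_derivative e) (at t within T (V, c))"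
          using e by (rule has_vector_derivative_at_within)
        ultimately show ?thesis by (intro vector_derivative_unique_within)
      qed
      then have "((\<lambda>s. G (\<mu> s)) has_vector_derivative V *v d) (at t within {0..1})"
        if "V \<in> J (\<mu> t)" for V
        using has_vector_derivative_at_within[OF e] that by simp
      then show ?thesis
        using has_vector_derivative_at_within[OF d] by (intro exI[of _ d] conjI ballI)
    qed
    have "AE t in lebesgue. t \<in> {0..1} \<longrightarrow> (\<exists>d. (\<mu> has_vector_derivative d) (at t within {0..1}) \<and>
        (\<forall>V\<in>J (\<mu> t). ((\<lambda>s. G (\<mu> s)) has_vector_derivative V *v d) (at t within {0..1})))"
    proof (rule AE_I')
      show "B \<in> null_sets lebesgue" using \<open>negligible B\<close> by (simp add: negligible_iff_null_sets)
    qed (use deriv in blast)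
    then show "AE t in lebesgue_on {0..1}. \<exists>d. (\<mu> has_vector_derivative d) (at t within {0..1}) \<and>
        (\<forall>V\<in>J (\<mu> t). ((\<lambda>s. G (\<mu> s)) has_vector_derivative V *v d) (at t within {0..1}))"
      by (subst AE_restrict_space_iff) simp_all
  qed
  then show "\<exists>J. conservative_jacobian G J" by (rule exI[of _ J])
qed

section \<open>The minimal norm LASSO solution\<close>

text \<open>Division by \<epsilon> > 0 and passage to the limit remove the second-order term. This
  extracts first-order conditions from minimality.\<close>

lemma eventually_quadratic_nonneg_imp:
  fixes b c :: real
  assumes "\<forall>\<^sub>F \<epsilon> in at_right 0. 0 \<le> \<epsilon> * b + \<epsilon>\<^sup>2 * c"
  shows "0 \<le> b"
proof (rule tendsto_lowerbound)
  show "((\<lambda>\<epsilon>. b + \<epsilon> * c) \<longlongrightarrow> b) (at_right 0)"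
    by (auto intro!: tendsto_eq_intros)
  show "\<forall>\<^sub>F \<epsilon> in at_right 0. 0 \<le> b + \<epsilon> * c"
    using assms eventually_at_right_less[of "0 :: real"]
  proof eventually_elim
    case (elim \<epsilon>)
    have "0 \<le> \<epsilon> * (b + \<epsilon> * c)" using elim(1) by (simp add: power2_eq_square algebra_simps)
    then show ?case using elim(2) by (simp add: zero_le_mult_iff)
  qed
qed simp

text \<open>This is the one-sided directional derivative of the l1 norm at \<open>x\<close> along
  \<open>h\<close>.\<close>

definition l1_dir :: "real ^ 'n \<Rightarrow> real ^ 'n \<Rightarrow> real"
  where "l1_dir x h = (\<Sum>i\<in>UNIV. if x $ i = 0 then \<bar>h $ i\<bar> else sgn (x $ i) * h $ i)"

text \<open>The expansion is exact because a small step preserves the signs of the nonzero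
  coordinates.\<close>

lemma l1_dir_eventually:
  "\<forall>\<^sub>F \<epsilon> in at_right 0. (\<Sum>i\<in>UNIV. \<bar>(x + \<epsilon> *\<^sub>R h) $ i\<bar>) = (\<Sum>i\<in>UNIV. \<bar>x $ i\<bar>) + \<epsilon> * l1_dir x h"
proof -
  have "\<forall>\<^sub>F \<epsilon> in at_right 0. \<bar>x $ i + \<epsilon> * h $ i\<bar> =
      \<bar>x $ i\<bar> + \<epsilon> * (if x $ i = 0 then \<bar>h $ i\<bar> else sgn (x $ i) * h $ i)" for i
  proof (cases "x $ i = 0")
    case True
    show ?thesis
      using eventually_at_right_less[of "0 :: real"] by eventually_elim (simp add: True abs_mult)
  next
    case False
    have "((\<lambda>\<epsilon>. \<bar>\<epsilon> * h $ i\<bar>) \<longlongrightarrow> \<bar>0 * h $ i\<bar>) (at_right 0)"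
      by (intro tendsto_intros)
    then have "\<forall>\<^sub>F \<epsilon> in at_right 0. \<bar>\<epsilon> * h $ i\<bar> < \<bar>x $ i\<bar>"
      using False by (intro order_tendstoD(2)) auto
    then show ?thesis
      by eventually_elim (use False in \<open>auto simp: sgn_if abs_if split: if_splits\<close>)
  qed
  then have "\<forall>\<^sub>F \<epsilon> in at_right 0. \<forall>i. \<bar>x $ i + \<epsilon> * h $ i\<bar> =
      \<bar>x $ i\<bar> + \<epsilon> * (if x $ i = 0 then \<bar>h $ i\<bar> else sgn (x $ i) * h $ i)"
    by (intro eventually_all_finite) auto
  then show ?thesis
  proof eventually_elim
    case (elim \<epsilon>)
    have "(\<Sum>i\<in>UNIV. \<bar>(x + \<epsilon> *\<^sub>R h) $ i\<bar>) =
        (\<Sum>i\<in>UNIV. \<bar>x $ i\<bar> + \<epsilon> * (if x $ i = 0 then \<bar>h $ i\<bar> else sgn (x $ i) * h $ i))"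
      using elim by (intro sum.cong) simp_all
    then show ?case by (simp only: sum.distrib l1_dir_def flip: sum_distrib_left)
  qed
qed

text \<open>Convexity of the l1 norm, checked in each coordinate.\<close>

lemma l1_dir_le: "l1_dir x h \<le> (\<Sum>i\<in>UNIV. \<bar>(x + h) $ i\<bar>) - (\<Sum>i\<in>UNIV. \<bar>x $ i\<bar>)"
  unfolding l1_dir_def sum_subtractf[symmetric]
  by (intro sum_mono) (auto simp: sgn_if abs_if)

lemma l1_dir_supported:
  assumes "\<And>i. x $ i = 0 \<Longrightarrow> h $ i = 0"
  shows "l1_dir x h = (\<chi> i. sgn (x $ i)) \<bullet> h"
  unfolding l1_dir_def inner_vec_def using assms by (intro sum.cong) auto

text \<open>Nonzero coordinates of the limit eventually have the right sign in \<open>X k\<close>; a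
  zero coordinate of the limit contributes the largest possible value
  \<open>\<bar>h $ i\<bar>\<close>.\<close>

lemma l1_dir_upper_semicontinuous:
  assumes "(X \<longlongrightarrow> x) F"
  shows "\<forall>\<^sub>F k in F. l1_dir (X k) h \<le> l1_dir x h"
proof -
  have "\<forall>\<^sub>F k in F. (if X k $ i = 0 then \<bar>h $ i\<bar> else sgn (X k $ i) * h $ i)
      \<le> (if x $ i = 0 then \<bar>h $ i\<bar> else sgn (x $ i) * h $ i)" for i
  proof (cases "x $ i = 0")
    case True
    then show ?thesis by (intro always_eventually) (auto simp: sgn_if abs_if)
  next
    case False
    have lim: "((\<lambda>k. X k $ i) \<longlongrightarrow> x $ i) F" using assms by (rule tendsto_vec_nth)
    show ?thesis
    proof (cases "x $ i > 0")
      case True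
      show ?thesis using order_tendstoD(1)[OF lim True] by eventually_elim (use True in simp)
    next
      case 2: False
      then have neg: "x $ i < 0" using False by simp
      show ?thesis using order_tendstoD(2)[OF lim neg] by eventually_elim (use neg in simp)
    qed
  qed
  then have "\<forall>\<^sub>F k in F. \<forall>i. (if X k $ i = 0 then \<bar>h $ i\<bar> else sgn (X k $ i) * h $ i)
      \<le> (if x $ i = 0 then \<bar>h $ i\<bar> else sgn (x $ i) * h $ i)"
    by (intro eventually_all_finite) auto
  then show ?thesis
    by eventually_elim (auto simp: l1_dir_def intro: sum_mono)
qed

lemma lasso_objective_add:
  "lasso_objective A lam \<theta> (x + h) = lasso_objective A lam \<theta> x + (A *v x - \<theta>) \<bullet> (A *v h)
    + 1 / 2 * (norm (A *v h))\<^sup>2 + exp lam * ((\<Sum>i\<in>UNIV. \<bar>(x + h) $ i\<bar>) - (\<Sum>i\<in>UNIV. \<bar>x $ i\<bar>))"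
proof -
  have "A *v (x + h) - \<theta> = (A *v x - \<theta>) + A *v h"
    by (simp add: matrix_vector_right_distrib)
  then have "(norm (A *v (x + h) - \<theta>))\<^sup>2 =
      (norm (A *v x - \<theta>))\<^sup>2 + 2 * ((A *v x - \<theta>) \<bullet> (A *v h)) + (norm (A *v h))\<^sup>2"
    by (simp only: dot_norm) (simp add: field_simps)
  then show ?thesis unfolding lasso_objective_def by (simp add: algebra_simps)
qed

lemma lasso_solutions_iff:
  "x \<in> lasso_solutions A lam \<theta> \<longleftrightarrow> (\<forall>y. lasso_objective A lam \<theta> x \<le> lasso_objective A lam \<theta> y)"
  by (simp add: lasso_solutions_def is_arg_min_linorder)

lemma lasso_objective_dir_eventually:
  "\<forall>\<^sub>F \<epsilon> in at_right 0. lasso_objective A lam \<theta> (x + \<epsilon> *\<^sub>R h) = lasso_objective A lam \<theta> x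
    + (\<epsilon> * ((A *v x - \<theta>) \<bullet> (A *v h) + exp lam * l1_dir x h) + \<epsilon>\<^sup>2 * (1 / 2 * (norm (A *v h))\<^sup>2))"
  using l1_dir_eventually[of x h]
proof eventually_elim
  case (elim \<epsilon>)
  then have "(\<Sum>i\<in>UNIV. \<bar>(x + \<epsilon> *\<^sub>R h) $ i\<bar>) - (\<Sum>i\<in>UNIV. \<bar>x $ i\<bar>) = \<epsilon> * l1_dir x h"
    by linarith
  then show ?case
    unfolding lasso_objective_add[of A lam \<theta> x]
    by (simp add: matrix_vector_mult_scaleR power_mult_distrib algebra_simps)
qed

lemma lasso_solution_dir:
  assumes "x \<in> lasso_solutions A lam \<theta>"
  shows "0 \<le> (A *v x - \<theta>) \<bullet> (A *v h) + exp lam * l1_dir x h"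
proof (rule eventually_quadratic_nonneg_imp)
  show "\<forall>\<^sub>F \<epsilon> in at_right 0. 0 \<le> \<epsilon> * ((A *v x - \<theta>) \<bullet> (A *v h) + exp lam * l1_dir x h)
      + \<epsilon>\<^sup>2 * (1 / 2 * (norm (A *v h))\<^sup>2)"
    using lasso_objective_dir_eventually[of A lam \<theta> x h]
  proof eventually_elim
    case (elim \<epsilon>)
    have "lasso_objective A lam \<theta> x \<le> lasso_objective A lam \<theta> (x + \<epsilon> *\<^sub>R h)"
      using assms unfolding lasso_solutions_iff ..
    with elim show ?case by linarith
  qed
qed

text \<open>With equal objective values, the first-order condition and convexity leave no room for
  the quadratic term, so \<open>A *v (z - x)\<close> vanishes. Then the l1 norms agree, and
  convexity bounds the directional derivative.\<close>

lemma lasso_solutions_diff: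
  assumes x: "x \<in> lasso_solutions A lam \<theta>" and z: "z \<in> lasso_solutions A lam \<theta>"
  shows "A *v (z - x) = 0" "l1_dir x (z - x) \<le> 0"
proof -
  let ?h = "z - x"
  let ?d = "(\<Sum>i\<in>UNIV. \<bar>(x + ?h) $ i\<bar>) - (\<Sum>i\<in>UNIV. \<bar>x $ i\<bar>)"
  have "lasso_objective A lam \<theta> (x + ?h) = lasso_objective A lam \<theta> x"
    using x z unfolding lasso_solutions_iff by (simp add: order_antisym)
  then have eq: "(A *v x - \<theta>) \<bullet> (A *v ?h) + 1 / 2 * (norm (A *v ?h))\<^sup>2 + exp lam * ?d = 0"
    unfolding lasso_objective_add[of A lam \<theta> x ?h] by linarith
  have le: "exp lam * l1_dir x ?h \<le> exp lam * ?d"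
    by (intro mult_left_mono l1_dir_le) simp
  have "(norm (A *v ?h))\<^sup>2 \<le> 0"
    using eq le lasso_solution_dir[OF x, of ?h] by linarith
  then show "A *v ?h = 0" by simp
  then have "exp lam * ?d = 0" using eq by simp
  then show "l1_dir x ?h \<le> 0" using le by (simp add: mult_le_0_iff)
qed

text \<open>Coercivity, used both for existence and for bounding solutions on bounded parameter
  sets.\<close>

lemma lasso_objective_ge: "exp lam * norm x \<le> lasso_objective A lam \<theta> x"
proof -
  have "exp lam * norm x \<le> exp lam * (\<Sum>i\<in>UNIV. \<bar>x $ i\<bar>)"
    by (intro mult_left_mono norm_le_l1_cart) simp
  then show ?thesis by (simp add: lasso_objective_def add_increasing)
qed

lemma tendsto_lasso_objective:
  assumes "(T \<longlongrightarrow> \<theta>) F" "(X \<longlongrightarrow> x) F"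
  shows "((\<lambda>k. lasso_objective A lam (T k) (X k)) \<longlongrightarrow> lasso_objective A lam \<theta> x) F"
  unfolding lasso_objective_def
  by (intro tendsto_intros assms bounded_linear.tendsto[OF matrix_vector_mul_bounded_linear])

section \<open>Existence of minimal norm solutions\<close>

lemma lasso_solutions_nonempty: "lasso_solutions A lam \<theta> \<noteq> {}"
proof -
  let ?f = "lasso_objective A lam \<theta>"
  \<comment> \<open>Outside this ball the coercive lower bound already exceeds the value at
    0.\<close>
  define R where "R = ?f 0 / exp lam"
  have "R \<ge> 0" by (simp add: R_def lasso_objective_def)
  have "continuous_on (cball 0 R) ?f"
    unfolding continuous_on_def by (intro ballI tendsto_lasso_objective tendsto_intros)
  then obtain x where x: "x \<in> cball 0 R" "\<And>y. y \<in> cball 0 R \<Longrightarrow> ?f x \<le> ?f y"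
    using continuous_attains_inf[of "cball 0 R" ?f] \<open>R \<ge> 0\<close> by auto
  have "?f x \<le> ?f y" for y
  proof (cases "y \<in> cball 0 R")
    case False
    then have "?f 0 \<le> exp lam * norm y" by (simp add: R_def field_simps)
    moreover have "?f x \<le> ?f 0" using x(2) \<open>R \<ge> 0\<close> by simp
    ultimately show ?thesis using lasso_objective_ge[of lam y A \<theta>] by linarith
  qed (rule x(2))
  then show ?thesis using lasso_solutions_iff by blast
qed

lemma closed_lasso_solutions: "closed (lasso_solutions A lam \<theta>)"
proof -
  have "lasso_solutions A lam \<theta> = (\<Inter>y. {x. lasso_objective A lam \<theta> x \<le> lasso_objective A lam \<theta> y})"
    using lasso_solutions_iff by blast
  moreover have "closed {x. lasso_objective A lam \<theta> x \<le> lasso_objective A lam \<theta> y}" for y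
    by (intro closed_Collect_le continuous_intros)
       (auto simp: continuous_on_def intro!: tendsto_lasso_objective tendsto_intros)
  ultimately show ?thesis by auto
qed

text \<open>The closed nonempty solution set has a point nearest to 0, so the choice behind
  \<open>arg_min_on\<close> has a witness.\<close>

lemma lasso_min_norm_props:
  shows "lasso_min_norm A lam \<theta> \<in> lasso_solutions A lam \<theta>"
    and "y \<in> lasso_solutions A lam \<theta> \<Longrightarrow> norm (lasso_min_norm A lam \<theta>) \<le> norm y"
proof -
  obtain x where "x \<in> lasso_solutions A lam \<theta>" "\<And>y. y \<in> lasso_solutions A lam \<theta> \<Longrightarrow> dist 0 x \<le> dist 0 y"
    by (rule distance_attains_inf[OF closed_lasso_solutions lasso_solutions_nonempty, where a = 0])
      (rule that)
  then have "is_arg_min norm (\<lambda>x. x \<in> lasso_solutions A lam \<theta>) x"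
    by (simp add: is_arg_min_linorder)
  then have "is_arg_min norm (\<lambda>x. x \<in> lasso_solutions A lam \<theta>) (lasso_min_norm A lam \<theta>)"
    unfolding lasso_min_norm_def arg_min_on_def arg_min_def by (rule someI)
  then show "lasso_min_norm A lam \<theta> \<in> lasso_solutions A lam \<theta>"
    "y \<in> lasso_solutions A lam \<theta> \<Longrightarrow> norm (lasso_min_norm A lam \<theta>) \<le> norm y"
    by (simp_all add: is_arg_min_linorder)
qed

section \<open>Continuity of the minimal norm solution\<close>

text \<open>Small steps along \<open>h\<close> stay optimal, so they cannot shorten the solution.
  The hypotheses see the parameter only through the solution, so \<open>h\<close> may come from a
  different parameter.\<close>

lemma lasso_min_norm_dir:
  assumes Ah: "A *v h = 0" and le: "l1_dir (lasso_min_norm A lam \<theta>) h \<le> 0"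
  shows "0 \<le> lasso_min_norm A lam \<theta> \<bullet> h"
proof -
  let ?x = "lasso_min_norm A lam \<theta>"
  have "0 \<le> 2 * (?x \<bullet> h)"
  proof (rule eventually_quadratic_nonneg_imp)
    show "\<forall>\<^sub>F \<epsilon> in at_right 0. 0 \<le> \<epsilon> * (2 * (?x \<bullet> h)) + \<epsilon>\<^sup>2 * (h \<bullet> h)"
      using lasso_objective_dir_eventually[of A lam \<theta> ?x h] eventually_at_right_less[of "0 :: real"]
    proof eventually_elim
      case (elim \<epsilon>)
      have "\<epsilon> * (exp lam * l1_dir ?x h) \<le> 0"
        using elim(2) le by (simp add: mult_le_0_iff)
      then have "lasso_objective A lam \<theta> (?x + \<epsilon> *\<^sub>R h) \<le> lasso_objective A lam \<theta> ?x"
        using elim(1) Ah by simp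
      then have "?x + \<epsilon> *\<^sub>R h \<in> lasso_solutions A lam \<theta>"
        using lasso_min_norm_props(1)[of A lam \<theta>] unfolding lasso_solutions_iff
        by (blast intro: order_trans)
      then have "?x \<bullet> ?x \<le> (?x + \<epsilon> *\<^sub>R h) \<bullet> (?x + \<epsilon> *\<^sub>R h)"
        using lasso_min_norm_props(2) by (simp flip: norm_le)
      then show ?case
        by (simp add: algebra_simps inner_commute power2_eq_square)
    qed
  qed
  then show ?thesis by simp
qed

lemma lasso_min_norm_closed_graph:
  assumes T: "T \<longlonglongrightarrow> \<theta>" and X: "(\<lambda>k. lasso_min_norm A lam (T k)) \<longlonglongrightarrow> x"
  shows "x = lasso_min_norm A lam \<theta>"
proof (rule ccontr)
  assume "x \<noteq> lasso_min_norm A lam \<theta>"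
  let ?z = "lasso_min_norm A lam \<theta>"
  define h where "h = ?z - x"
  have "h \<noteq> 0" using \<open>x \<noteq> ?z\<close> by (simp add: h_def)
  \<comment> \<open>Optimality against each fixed competitor passes to the limit.\<close>
  have x: "x \<in> lasso_solutions A lam \<theta>"
    unfolding lasso_solutions_iff
  proof
    fix y
    show "lasso_objective A lam \<theta> x \<le> lasso_objective A lam \<theta> y"
    proof (rule tendsto_le[OF sequentially_bot])
      show "(\<lambda>k. lasso_objective A lam (T k) y) \<longlonglongrightarrow> lasso_objective A lam \<theta> y"
        "(\<lambda>k. lasso_objective A lam (T k) (lasso_min_norm A lam (T k))) \<longlonglongrightarrow> lasso_objective A lam \<theta> x"
        by (intro tendsto_lasso_objective T X tendsto_const)+
      show "\<forall>\<^sub>F k in sequentially. lasso_objective A lam (T k) (lasso_min_norm A lam (T k))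
          \<le> lasso_objective A lam (T k) y"
        using lasso_min_norm_props(1) unfolding lasso_solutions_iff by (intro always_eventually) blast
    qed
  qed
  have Ah: "A *v h = 0" and D: "l1_dir x h \<le> 0"
    using lasso_solutions_diff[OF x lasso_min_norm_props(1)] by (simp_all add: h_def)
  have "norm (x + h) \<le> norm x"
    using lasso_min_norm_props(2)[OF x] by (simp add: h_def)
  then have "2 * (x \<bullet> h) + h \<bullet> h \<le> 0"
    by (simp add: norm_le algebra_simps inner_commute)
  moreover have "h \<bullet> h > 0" using \<open>h \<noteq> 0\<close> by simp
  ultimately have "x \<bullet> h < 0" by linarith
  have "(\<lambda>k. lasso_min_norm A lam (T k) \<bullet> h) \<longlonglongrightarrow> x \<bullet> h"
    by (intro tendsto_intros X)
  then have "\<forall>\<^sub>F k in sequentially. lasso_min_norm A lam (T k) \<bullet> h < 0"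
    using \<open>x \<bullet> h < 0\<close> by (rule order_tendstoD(2))
  \<comment> \<open>By upper semicontinuity \<open>h\<close> is an admissible direction for the
    approximating solutions too, yet it would shorten them.\<close>
  then have "\<forall>\<^sub>F k in sequentially. False"
    using l1_dir_upper_semicontinuous[OF X, of h]
  proof eventually_elim
    case (elim k)
    then show ?case using lasso_min_norm_dir[OF Ah, of lam "T k"] D by linarith
  qed
  then show False by simp
qed

text \<open>A map into a compact set with closed graph is continuous; coercivity supplies the
  compact set on each ball.\<close>

lemma continuous_lasso_min_norm:
  fixes A :: "real ^ 'n ^ 'm"
  shows "continuous_on UNIV (lasso_min_norm A lam)"
proof -
  have "continuous_on (cball 0 r) (lasso_min_norm A lam)" for r
  proof (rule continuous_from_closed_graph)
    \<comment> \<open>Comparison with the zero vector, whose objective is half of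
      \<open>(norm \<theta>)\<^sup>2\<close>, gives this radius.\<close>
    let ?R = "r\<^sup>2 / 2 / exp lam"
    show "compact (cball (0 :: real ^ 'n) ?R)" by simp
    show "lasso_min_norm A lam \<in> cball 0 r \<rightarrow> cball 0 ?R"
    proof
      fix \<theta> :: "real ^ 'm" assume "\<theta> \<in> cball 0 r"
      then have "(norm \<theta>)\<^sup>2 \<le> r\<^sup>2" by (simp add: power_mono)
      have "exp lam * norm (lasso_min_norm A lam \<theta>) \<le> lasso_objective A lam \<theta> (lasso_min_norm A lam \<theta>)"
        by (rule lasso_objective_ge)
      also have "\<dots> \<le> lasso_objective A lam \<theta> 0"
        using lasso_min_norm_props(1) unfolding lasso_solutions_iff by blast
      also have "\<dots> \<le> r\<^sup>2 / 2" using \<open>(norm \<theta>)\<^sup>2 \<le> r\<^sup>2\<close> by (simp add: lasso_objective_def)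
      finally show "lasso_min_norm A lam \<theta> \<in> cball 0 ?R" by (simp add: field_simps)
    qed
    show "closed ((\<lambda>\<theta>. (\<theta>, lasso_min_norm A lam \<theta>)) ` cball 0 r)"
      unfolding closed_sequential_limits
    proof (intro allI impI, elim conjE)
      fix s l assume s: "\<forall>n. s n \<in> (\<lambda>\<theta>. (\<theta>, lasso_min_norm A lam \<theta>)) ` cball 0 r" and lim: "s \<longlonglongrightarrow> l"
      have lims: "(\<lambda>n. fst (s n)) \<longlonglongrightarrow> fst l" "(\<lambda>n. snd (s n)) \<longlonglongrightarrow> snd l"
        by (rule tendsto_fst[OF lim], rule tendsto_snd[OF lim])
      have sn: "snd (s n) = lasso_min_norm A lam (fst (s n))" "fst (s n) \<in> cball 0 r" for n
      proof -
        obtain \<theta> where "\<theta> \<in> cball 0 r" "s n = (\<theta>, lasso_min_norm A lam \<theta>)" using s by blast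
        then show "snd (s n) = lasso_min_norm A lam (fst (s n))" "fst (s n) \<in> cball 0 r" by simp_all
      qed
      have "snd l = lasso_min_norm A lam (fst l)"
        using lims unfolding sn(1) by (rule lasso_min_norm_closed_graph)
      moreover have "fst l \<in> cball 0 r"
        using closed_sequentially[OF closed_cball _ lims(1)] sn(2) by blast
      ultimately show "l \<in> (\<lambda>\<theta>. (\<theta>, lasso_min_norm A lam \<theta>)) ` cball 0 r"
        by (intro image_eqI[of _ _ "fst l"]) (simp_all add: prod_eq_iff)
    qed
  qed
  then have "isCont (lasso_min_norm A lam) \<theta>" for \<theta>
    using continuous_on_interior[of "cball 0 (norm \<theta> + 1)" "lasso_min_norm A lam" \<theta>]
    by (simp add: interior_cball)
  then show ?thesis by (simp add: continuous_at_imp_continuous_on)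
qed

section \<open>Affine dependence on each sign class\<close>

text \<open>On directions supported where the solution is nonzero, the l1 derivative is linear;
  applying the inequalities to \<open>h\<close> and \<open>- h\<close> turns them into
  equalities.\<close>

lemma lasso_min_norm_support:
  assumes h: "\<And>i. lasso_min_norm A lam \<theta> $ i = 0 \<Longrightarrow> h $ i = 0"
  shows "(A *v lasso_min_norm A lam \<theta> - \<theta>) \<bullet> (A *v h)
      + exp lam * ((\<chi> i. sgn (lasso_min_norm A lam \<theta> $ i)) \<bullet> h) = 0" (is ?kkt)
    and "A *v h = 0 \<Longrightarrow> lasso_min_norm A lam \<theta> \<bullet> h = 0"
proof -
  let ?x = "lasso_min_norm A lam \<theta>"
  let ?s = "\<chi> i. sgn (?x $ i)"
  have dir: "l1_dir ?x h = ?s \<bullet> h" "l1_dir ?x (- h) = - (?s \<bullet> h)"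
    using l1_dir_supported[of ?x h] l1_dir_supported[of ?x "- h"] h by simp_all
  have neg: "A *v (- h) = - (A *v h)" using matrix_vector_mult_scaleR[of A "- 1" h] by simp
  show kkt: ?kkt
    using lasso_solution_dir[OF lasso_min_norm_props(1)[of A lam \<theta>], of h]
      lasso_solution_dir[OF lasso_min_norm_props(1)[of A lam \<theta>], of "- h"]
    unfolding dir neg by simp
  show "?x \<bullet> h = 0" if "A *v h = 0"
  proof -
    have "?s \<bullet> h = 0" using kkt that by simp
    then show ?thesis
      using lasso_min_norm_dir[OF that, of lam \<theta>] lasso_min_norm_dir[of A "- h" lam \<theta>] that
      by (simp add: dir neg)
  qed
qed

text \<open>Subtracting the optimality conditions at two parameters of the class cancels the sign
  term. The difference of solutions then solves a linear equation that is injective on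
  \<open>V\<close>, and a linear left inverse recovers it.\<close>

lemma lasso_min_norm_affine_on_sign_class:
  fixes A :: "real ^ 'n ^ 'm" and \<sigma> :: "real ^ 'n"
  shows "\<exists>p. \<forall>\<theta>. (\<chi> i. sgn (lasso_min_norm A lam \<theta> $ i)) = \<sigma> \<longrightarrow>
    lasso_min_norm A lam \<theta> = fst p *v \<theta> + snd p"
proof (cases "\<exists>\<theta>. (\<chi> i. sgn (lasso_min_norm A lam \<theta> $ i)) = \<sigma>")
  case True
  let ?G = "lasso_min_norm A lam"
  obtain \<theta>0 where \<theta>0: "(\<chi> i. sgn (?G \<theta>0 $ i)) = \<sigma>" using True by blast
  define S where "S = {d :: real ^ 'n. \<forall>i. \<sigma> $ i = 0 \<longrightarrow> d $ i = 0}"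
  \<comment> \<open>\<open>V\<close> is the orthogonal complement, within \<open>S\<close>, of the
    kernel of \<open>A\<close> on \<open>S\<close>.\<close>
  define V where "V = {d \<in> S. \<forall>h\<in>S. A *v h = 0 \<longrightarrow> d \<bullet> h = 0}"
  define P where "P y = (\<chi> i. if \<sigma> $ i = 0 then 0 else y $ i)" for y :: "real ^ 'n"
  have P: "P y \<bullet> h = y \<bullet> h" if "h \<in> S" for y h
    unfolding P_def inner_vec_def using that by (intro sum.cong) (auto simp: S_def)
  have "linear P" by (rule linearI) (simp_all add: P_def vec_eq_iff)
  have linA: "linear (\<lambda>y. y v* A)"
    unfolding transpose_matrix_vector[symmetric] by (rule matrix_vector_mul_linear)
  \<comment> \<open>\<open>Q y\<close> is the transpose of \<open>A\<close> applied to
    \<open>y\<close> and projected onto \<open>S\<close>; it is the element of \<open>S\<close>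
    representing the functional sending \<open>h\<close> to
    \<open>y \<bullet> (A *v h)\<close>.\<close>
  define Q where "Q y = P (y v* A)" for y
  have "linear Q" unfolding Q_def using linear_compose[OF linA \<open>linear P\<close>] by (simp add: o_def)
  have Q: "Q y \<bullet> h = y \<bullet> (A *v h)" if "h \<in> S" for y h
    unfolding Q_def P[OF that] by (rule dot_lmul_matrix)
  have Qext: "Q y = Q y'" if "\<And>h. h \<in> S \<Longrightarrow> y \<bullet> (A *v h) = y' \<bullet> (A *v h)" for y y'
  proof -
    have "Q y - Q y' \<in> S" by (simp add: S_def Q_def P_def)
    then have "(Q y - Q y') \<bullet> (Q y - Q y') = 0"
      using Q that by (simp add: inner_diff_left)
    then show ?thesis by simp
  qed
  have "linear (\<lambda>d. Q (A *v d))"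
    using linear_compose[OF matrix_vector_mul_linear[of A] \<open>linear Q\<close>] by (simp add: o_def)
  moreover have "subspace V"
    by (auto simp: V_def S_def subspace_def inner_add_left)
  moreover have "inj_on (\<lambda>d. Q (A *v d)) V"
  proof (rule inj_onI)
    fix d d' assume d: "d \<in> V" "d' \<in> V" and eq: "Q (A *v d) = Q (A *v d')"
    have "d - d' \<in> V" using \<open>subspace V\<close> d by (rule subspace_diff)
    then have "d - d' \<in> S" by (simp add: V_def)
    \<comment> \<open>Testing the equation with \<open>d - d'\<close> itself puts it in the kernel
      of \<open>A\<close>, to which members of \<open>V\<close> are orthogonal.\<close>
    then have "(A *v (d - d')) \<bullet> (A *v (d - d')) = 0"
      using Q[of "d - d'" "A *v d"] Q[of "d - d'" "A *v d'"] eq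
      by (simp add: matrix_vector_mult_diff_distrib inner_diff_left)
    then have "(d - d') \<bullet> (d - d') = 0"
      using \<open>d - d' \<in> V\<close> \<open>d - d' \<in> S\<close> by (simp add: V_def)
    then show "d = d'" by simp
  qed
  ultimately obtain g where g: "linear g" "\<And>d. d \<in> V \<Longrightarrow> g (Q (A *v d)) = d"
    using linear_exists_left_inverse_on by metis
  have "linear (\<lambda>y. g (Q y))"
    using linear_compose[OF \<open>linear Q\<close> g(1)] by (simp add: o_def)
  then have M: "matrix (\<lambda>y. g (Q y)) *v y = g (Q y)" for y
    by (simp add: matrix_works)
  have "?G \<theta> = g (Q \<theta>) + (?G \<theta>0 - g (Q \<theta>0))" if \<theta>: "(\<chi> i. sgn (?G \<theta> $ i)) = \<sigma>" for \<theta>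
  proof -
    have zero: "?G \<theta> $ i = 0 \<longleftrightarrow> \<sigma> $ i = 0" "?G \<theta>0 $ i = 0 \<longleftrightarrow> \<sigma> $ i = 0" for i
    proof -
      have "sgn (?G \<theta> $ i) = \<sigma> $ i" "sgn (?G \<theta>0 $ i) = \<sigma> $ i"
        using \<theta> \<theta>0 by (simp_all add: vec_eq_iff)
      then show "?G \<theta> $ i = 0 \<longleftrightarrow> \<sigma> $ i = 0" "?G \<theta>0 $ i = 0 \<longleftrightarrow> \<sigma> $ i = 0"
        by (metis sgn_zero_iff)+
    qed
    let ?d = "?G \<theta> - ?G \<theta>0"
    have "?d \<bullet> h = 0" if "h \<in> S" "A *v h = 0" for h
      using lasso_min_norm_support(2)[of A lam \<theta> h] lasso_min_norm_support(2)[of A lam \<theta>0 h] that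
      by (simp add: zero S_def inner_diff_left)
    moreover have "?d \<in> S"
    proof -
      have "?G \<theta> $ i = 0 \<and> ?G \<theta>0 $ i = 0" if "\<sigma> $ i = 0" for i
        using that zero by blast
      then show ?thesis unfolding S_def by simp
    qed
    ultimately have "?d \<in> V" by (simp add: V_def)
    \<comment> \<open>These are the normal equations restricted to the support.\<close>
    have "Q (A *v ?d) = Q (\<theta> - \<theta>0)"
    proof (rule Qext)
      fix h assume "h \<in> S"
      then have "(A *v ?G \<theta> - \<theta>) \<bullet> (A *v h) = (A *v ?G \<theta>0 - \<theta>0) \<bullet> (A *v h)"
        using lasso_min_norm_support(1)[of A lam \<theta> h] lasso_min_norm_support(1)[of A lam \<theta>0 h]
        by (simp add: zero S_def \<theta> \<theta>0)
      then show "(A *v ?d) \<bullet> (A *v h) = (\<theta> - \<theta>0) \<bullet> (A *v h)"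
        by (simp add: matrix_vector_mult_diff_distrib inner_diff_left)
    qed
    then have "?d = g (Q (\<theta> - \<theta>0))" using g(2)[OF \<open>?d \<in> V\<close>] by simp
    also have "\<dots> = g (Q \<theta>) - g (Q \<theta>0)"
      using \<open>linear Q\<close> g(1) by (simp add: linear_diff)
    finally show ?thesis by (simp add: algebra_simps)
  qed
  then show ?thesis
    using M by (intro exI[of _ "(matrix (\<lambda>y. g (Q y)), ?G \<theta>0 - g (Q \<theta>0))"]) simp
qed blast

lemma finite_sign_vectors: "finite {\<sigma> :: real ^ 'n. \<forall>i. \<sigma> $ i \<in> {- 1, 0, 1}}" (is "finite ?S")
proof (rule finite_subset)
  show "?S \<subseteq> (\<lambda>f. \<chi> i. f i) ` (UNIV \<rightarrow>\<^sub>E {- 1, 0, 1})"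
  proof
    fix \<sigma> :: "real ^ 'n" assume "\<sigma> \<in> ?S"
    then have "($) \<sigma> \<in> UNIV \<rightarrow>\<^sub>E {- 1, 0, 1}" by auto
    then show "\<sigma> \<in> (\<lambda>f. \<chi> i. f i) ` (UNIV \<rightarrow>\<^sub>E {- 1, 0, 1})"
      by (rule image_eqI[rotated]) simp
  qed
qed (intro finite_imageI finite_PiE; simp)


theorem corollary28:
  fixes A :: "real ^ 'n ^ 'm" and lam :: real
  shows "path_differentiable (\<lambda>\<theta> :: real ^ 'm. lasso_min_norm A lam \<theta>)"
proof -
  let ?s = "\<lambda>\<theta>. \<chi> i. sgn (lasso_min_norm A lam \<theta> $ i)"
  let ?P = "\<lambda>\<sigma> p. \<forall>\<theta>. ?s \<theta> = \<sigma> \<longrightarrow> lasso_min_norm A lam \<theta> = fst p *v \<theta> + snd p"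
  let ?S = "{\<sigma> :: real ^ 'n. \<forall>i. \<sigma> $ i \<in> {- 1, 0, 1}}"
  \<comment> \<open>A sign vector attained by no \<theta> satisfies the condition vacuously and
    receives an arbitrary pair.\<close>
  define p where "p \<sigma> = (SOME p. ?P \<sigma> p)" for \<sigma>
  have p: "?P \<sigma> (p \<sigma>)" for \<sigma>
    unfolding p_def by (rule someI_ex[OF lasso_min_norm_affine_on_sign_class])
  show ?thesis
  proof (rule path_differentiable_of_affine_selection[OF continuous_lasso_min_norm])
    show "finite (p ` ?S)" by (intro finite_imageI finite_sign_vectors)
    have "?s \<theta> \<in> ?S" for \<theta> by (simp add: sgn_if)
    then show "\<exists>q\<in>p ` ?S. lasso_min_norm A lam \<theta> = fst q *v \<theta> + snd q" for \<theta>
      using p[rule_format, OF refl] by blast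
  qed
qed

end
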